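(* Let $(N,d_N,\mu_N)$ be a geodesic doubling metric measure space and let $S=N\times\mathbb R_+$ be equipped with the metric $$d_S((x,y),(x',y'))=C_N\operatorname{arcosh}\left(1+\frac{d_N(x,x')^2+(y-y')^2}{2yy'}\right)$$ and the measure $\mathrm d\rho(x,a)=\frac{\mathrm d\mu_N(x)\,\mathrm da}{a}$. Then, for every $p\in[1,\infty)$ such that $N$ supports a global $L^p$-Poincaré inequality, $S$ also supports a global $L^p$-Poincaré inequality. Furthermore, for every such $p$ there exist positive constants $C_p$, $\mathcal C$ and $\mathcal R_0$ such that $$\int_{B_S(x_0,R)}|f-f_{B_S(x_0,R)}|^p\,\mathrm d\rho\le C_pR^p\int_{B_S(x_0,R+\mathcal C)}|g_f|^p\,\mathrm d\rho$$ for every $x_0\in S$, every $R\ge\mathcal R_0$, every locally integrable function $f$ on $S$, and every upper gradient $g_f$ of $f$.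
   Context: $\mathbb R_+=(0,\infty)$. A metric measure space is a metric space with a Borel measure. It is doubling if balls have positive finite measure and there is $C$ with $\mu(B(x,2r))\le C\mu(B(x,r))$ for all $x$ and $r>0$; it is geodesic if any two points are joined by a curve whose length equals their distance. $C_N>0$ is a fixed normalising constant (its precise value is irrelevant because global Poincaré inequalities are invariant under rescaling of the metric; the constants in the conclusion may depend on it). $B_X(x,r)$ denotes the ball of center $x$ and radius $r$ in a metric space $X$. For a ball $B$ in a metric measure space $(M,d_M,\mu)$, $f_B=\mu(B)^{-1}\int_B f\,\mathrm d\mu$. Locally integrable functions are understood to be integrable on balls, so that $f_B$ makes sense. Upper gradients are understood in the usual sense: a Borel function $g\ge 0$ is an upper gradient of $f$ if $|f(\gamma(0))-f(\gamma(L))|\le\int_\gamma g\,\mathrm ds$ for every rectifiable curve $\gamma:[0,L]\to M$. $(M,d_M,\mu)$ supports a global $L^p$-Poincaré inequality if there are constants $C>0$ and $\lambda\ge1$ such that $\int_B|f-f_B|^p\,\mathrm d\mu\le C\operatorname{rad}(B)^p\int_{\lambda B}g_f^p\,\mathrm d\mu$ for every ball $B$ of $M$ (of arbitrary radius $\operatorname{rad}(B)$; $\lambda B$ is the concentric ball of radius $\lambda\operatorname{rad}(B)$), every locally integrable $f$ and every upper gradient $g_f$ of $f$. *)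

theory Defs
  imports "HOL-Analysis.Analysis"
begin

section \<open>Metric measure spaces\<close>

abbreviation borel_alg :: "'a set \<Rightarrow> ('a \<Rightarrow> 'a \<Rightarrow> real) \<Rightarrow> 'a measure" where
  "borel_alg M d \<equiv> sigma M {U. openin (Metric_space.mtopology M d) U}"

locale metric_measure_space = Metric_space M d
  for M :: "'a set" and d :: "'a \<Rightarrow> 'a \<Rightarrow> real" +
  fixes \<mu> :: "'a measure"
  assumes space_mu: "space \<mu> = M"
    and sets_mu: "sets \<mu> = sets (borel_alg M d)"

definition doubling :: "'a set \<Rightarrow> ('a \<Rightarrow> 'a \<Rightarrow> real) \<Rightarrow> 'a measure \<Rightarrow> bool" where
  "doubling M d \<mu> \<longleftrightarrow>
     (\<forall>x\<in>M. \<forall>r>0. 0 < emeasure \<mu> (Metric_space.mball M d x r) \<and>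
                   emeasure \<mu> (Metric_space.mball M d x r) < \<infinity>) \<and>
     (\<exists>C::real. \<forall>x\<in>M. \<forall>r>0.
        emeasure \<mu> (Metric_space.mball M d x (2 * r))
          \<le> ennreal C * emeasure \<mu> (Metric_space.mball M d x r))"

section \<open>Curves\<close>

definition curve_in :: "'a set \<Rightarrow> ('a \<Rightarrow> 'a \<Rightarrow> real) \<Rightarrow> real \<Rightarrow> (real \<Rightarrow> 'a) \<Rightarrow> bool" where
  "curve_in M d L \<gamma> \<longleftrightarrow>
     0 \<le> L \<and> continuous_map (top_of_set {0..L}) (Metric_space.mtopology M d) \<gamma>"

definition curve_length :: "('a \<Rightarrow> 'a \<Rightarrow> real) \<Rightarrow> (real \<Rightarrow> 'a) \<Rightarrow> real \<Rightarrow> real \<Rightarrow> ennreal" where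
  "curve_length d \<gamma> a b =
     (SUP (n, t) \<in> {(n :: nat, t :: nat \<Rightarrow> real). t 0 = a \<and> t n = b \<and> mono_on {..n} t}.
        \<Sum>i<n. ennreal (d (\<gamma> (t i)) (\<gamma> (t (Suc i)))))"

definition rectifiable_curve ::
  "'a set \<Rightarrow> ('a \<Rightarrow> 'a \<Rightarrow> real) \<Rightarrow> real \<Rightarrow> (real \<Rightarrow> 'a) \<Rightarrow> bool" where
  "rectifiable_curve M d L \<gamma> \<longleftrightarrow> curve_in M d L \<gamma> \<and> curve_length d \<gamma> 0 L < \<infinity>"

text \<open>
  For a rectifiable curve the value below does not depend on the chosen \<open>t\<close>: the curve is
  constant on any interval on which the length function is constant.
\<close>

definition arclength_param ::
  "('a \<Rightarrow> 'a \<Rightarrow> real) \<Rightarrow> real \<Rightarrow> (real \<Rightarrow> 'a) \<Rightarrow> real \<Rightarrow> 'a" where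
  "arclength_param d L \<gamma> s = \<gamma> (SOME t. t \<in> {0..L} \<and> curve_length d \<gamma> 0 t = ennreal s)"

definition line_integral ::
  "('a \<Rightarrow> 'a \<Rightarrow> real) \<Rightarrow> real \<Rightarrow> (real \<Rightarrow> 'a) \<Rightarrow> ('a \<Rightarrow> ennreal) \<Rightarrow> ennreal" where
  "line_integral d L \<gamma> g =
     (\<integral>\<^sup>+s\<in>{0..enn2real (curve_length d \<gamma> 0 L)}. g (arclength_param d L \<gamma> s) \<partial>lborel)"

definition geodesic_space :: "'a set \<Rightarrow> ('a \<Rightarrow> 'a \<Rightarrow> real) \<Rightarrow> bool" where
  "geodesic_space M d \<longleftrightarrow>
     (\<forall>x\<in>M. \<forall>y\<in>M. \<exists>L \<gamma>. curve_in M d L \<gamma> \<and> \<gamma> 0 = x \<and> \<gamma> L = y \<and>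
                       curve_length d \<gamma> 0 L = ennreal (d x y))"

section \<open>Upper gradients and Poincare inequalities\<close>

text \<open>Upper gradients are allowed to take the value \<open>\<infinity>\<close>.\<close>

definition upper_gradient ::
  "'a set \<Rightarrow> ('a \<Rightarrow> 'a \<Rightarrow> real) \<Rightarrow> ('a \<Rightarrow> real) \<Rightarrow> ('a \<Rightarrow> ennreal) \<Rightarrow> bool" where
  "upper_gradient M d f g \<longleftrightarrow>
     g \<in> borel_measurable (borel_alg M d) \<and>
     (\<forall>L \<gamma>. rectifiable_curve M d L \<gamma> \<longrightarrow>
        ennreal \<bar>f (\<gamma> 0) - f (\<gamma> L)\<bar> \<le> line_integral d L \<gamma> g)"

definition ennreal_powr :: "ennreal \<Rightarrow> real \<Rightarrow> ennreal" where
  "ennreal_powr a p = (if a = \<infinity> then \<infinity> else ennreal (enn2real a powr p))"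

definition locally_integrable ::
  "'a set \<Rightarrow> ('a \<Rightarrow> 'a \<Rightarrow> real) \<Rightarrow> 'a measure \<Rightarrow> ('a \<Rightarrow> real) \<Rightarrow> bool" where
  "locally_integrable M d \<mu> f \<longleftrightarrow>
     (\<forall>x\<in>M. \<forall>r>0. set_integrable \<mu> (Metric_space.mball M d x r) f)"

definition mean_value :: "'a measure \<Rightarrow> 'a set \<Rightarrow> ('a \<Rightarrow> real) \<Rightarrow> real" where
  "mean_value \<mu> B f = (LINT x:B|\<mu>. f x) / measure \<mu> B"

definition supports_global_poincare ::
  "'a set \<Rightarrow> ('a \<Rightarrow> 'a \<Rightarrow> real) \<Rightarrow> 'a measure \<Rightarrow> real \<Rightarrow> bool" where
  "supports_global_poincare M d \<mu> p \<longleftrightarrow>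
     (\<exists>C>0. \<exists>\<Lambda>\<ge>1. \<forall>x\<in>M. \<forall>r>0. \<forall>f g.
        locally_integrable M d \<mu> f \<longrightarrow> upper_gradient M d f g \<longrightarrow>
        (let B = Metric_space.mball M d x r in
          (\<integral>\<^sup>+z\<in>B. ennreal (\<bar>f z - mean_value \<mu> B f\<bar> powr p) \<partial>\<mu>)
            \<le> ennreal (C * r powr p) *
              (\<integral>\<^sup>+z\<in>Metric_space.mball M d x (\<Lambda> * r). ennreal_powr (g z) p \<partial>\<mu>)))"

section \<open>The half-space over a metric measure space\<close>

definition half_space :: "'a set \<Rightarrow> ('a \<times> real) set" where
  "half_space N = N \<times> {0<..}"

text \<open>
  The value off the half-space is irrelevant; it is set to 0 because the locale
  \<open>Metric_space\<close> requires nonnegativity and symmetry on the whole type.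
\<close>

definition half_space_dist ::
  "real \<Rightarrow> ('a \<Rightarrow> 'a \<Rightarrow> real) \<Rightarrow> 'a \<times> real \<Rightarrow> 'a \<times> real \<Rightarrow> real" where
  "half_space_dist c dN = (\<lambda>(x, y) (x', y').
     if 0 < y \<and> 0 < y' then c * arcosh (1 + ((dN x x')\<^sup>2 + (y - y')\<^sup>2) / (2 * y * y'))
     else 0)"

definition half_space_measure :: "'a measure \<Rightarrow> ('a \<times> real) measure" where
  "half_space_measure \<mu>N =
     \<mu>N \<Otimes>\<^sub>M density (restrict_space lborel {0<..}) (\<lambda>a. ennreal (1 / a))"

text \<open>
  The half-space is again a metric measure space. In particular the product measure lives on
  the Borel sets of the metric, because the base space is separable.
\<close>

lemma half_space_metric:
  assumes "Metric_space N dN" "0 < c"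
  shows "Metric_space (half_space N) (half_space_dist c dN)"
proof -
  interpret Metric_space N dN by fact
  have ge1: "1 \<le> 1 + (s\<^sup>2 + t\<^sup>2) / (2 * y * y')" if "y > 0" "y' > 0" for s t y y' :: real
    using that by simp
  show ?thesis
  proof
    fix p q :: "'a \<times> real"
    obtain x y where p: "p = (x, y)" by (cases p)
    obtain x' y' where q: "q = (x', y')" by (cases q)
    show "half_space_dist c dN p q = half_space_dist c dN q p"
      by (simp add: p q half_space_dist_def commute power2_commute mult_ac)
  next
    fix p q :: "'a \<times> real"
    obtain x y where p: "p = (x, y)" by (cases p)
    obtain x' y' where q: "q = (x', y')" by (cases q)
    assume "p \<in> half_space N" "q \<in> half_space N"
    then have *: "x \<in> N" "x' \<in> N" "y > 0" "y' > 0" by (auto simp: p q half_space_def)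
    have "half_space_dist c dN p q = 0 \<longleftrightarrow> (dN x x')\<^sup>2 + (y - y')\<^sup>2 = 0"
      using * \<open>c > 0\<close> arcosh_eq_0_iff_real[OF ge1[OF *(3,4)]]
      by (auto simp: p q half_space_dist_def)
    then show "half_space_dist c dN p q = 0 \<longleftrightarrow> p = q"
      using * by (simp add: p q sum_power2_eq_zero_iff)
  next
    fix p q r :: "'a \<times> real"
    obtain x1 y1 where p: "p = (x1, y1)" by (cases p)
    obtain x2 y2 where q: "q = (x2, y2)" by (cases q)
    obtain x3 y3 where r: "r = (x3, y3)" by (cases r)
    assume "p \<in> half_space N" "q \<in> half_space N" "r \<in> half_space N"
    then have *: "x1 \<in> N" "x2 \<in> N" "x3 \<in> N" "y1 > 0" "y2 > 0" "y3 > 0"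
      by (auto simp: p q r half_space_def)
    define a b where "a = dN x1 x2" and "b = dN x2 x3"
    have ab: "0 \<le> a" "0 \<le> b" by (auto simp: a_def b_def)
    define P Q where "P = 1 + (a\<^sup>2 + (y1 - y2)\<^sup>2) / (2 * y1 * y2)"
      and "Q = 1 + (b\<^sup>2 + (y2 - y3)\<^sup>2) / (2 * y2 * y3)"
    define T where "T = 1 + ((dN x1 x3)\<^sup>2 + (y1 - y3)\<^sup>2) / (2 * y1 * y3)"
    have PQT: "1 \<le> P" "1 \<le> Q" "1 \<le> T"
      unfolding P_def Q_def T_def using * ge1 by auto
    define X Y s where "X = a\<^sup>2 + y1\<^sup>2" and "Y = b\<^sup>2 + y3\<^sup>2" and "s = y2\<^sup>2"
    have P: "P = (X + s) / (2 * y1 * y2)" and Q: "Q = (Y + s) / (2 * y2 * y3)"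
      using * by (auto simp: P_def Q_def X_def Y_def s_def field_simps power2_eq_square)
    have P2: "P\<^sup>2 - 1 = ((X - s)\<^sup>2 + (2 * a * y2)\<^sup>2) / (2 * y1 * y2)\<^sup>2"
      and Q2: "Q\<^sup>2 - 1 = ((Y - s)\<^sup>2 + (2 * b * y2)\<^sup>2) / (2 * y2 * y3)\<^sup>2"
      unfolding P Q using * 
      by (auto simp: X_def Y_def s_def field_simps power2_eq_square)
    have sP: "sqrt (P\<^sup>2 - 1) = sqrt ((X - s)\<^sup>2 + (2 * a * y2)\<^sup>2) / (2 * y1 * y2)"
      and sQ: "sqrt (Q\<^sup>2 - 1) = sqrt ((Y - s)\<^sup>2 + (2 * b * y2)\<^sup>2) / (2 * y2 * y3)"
      unfolding P2 Q2 using * by (simp_all add: real_sqrt_divide)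
    have alg: "(A + G * H) / (4 * y1 * s * y3)
        = A1 / (2 * y1 * y2) * (B1 / (2 * y2 * y3)) + G / (2 * y1 * y2) * (H / (2 * y2 * y3))"
      if "A = A1 * B1" for A A1 B1 G H
      using * that by (simp add: s_def add_divide_distrib power2_eq_square)
    have "(dN x1 x3)\<^sup>2 \<le> (a + b)\<^sup>2"
      using triangle[of x1 x2 x3] * by (intro power_mono) (auto simp: a_def b_def)
    then have "T \<le> 1 + ((a + b)\<^sup>2 + (y1 - y3)\<^sup>2) / (2 * y1 * y3)"
      unfolding T_def using * by (intro add_left_mono divide_right_mono add_right_mono) auto
    also have "\<dots> = ((X + s) * (Y + s) + 4 * a * b * s - (X - s) * (Y - s)) / (4 * y1 * s * y3)"
      using * by (simp add: X_def Y_def s_def field_simps power2_eq_square)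
    also have "\<dots> \<le> ((X + s) * (Y + s) + sqrt ((X - s)\<^sup>2 + (2 * a * y2)\<^sup>2) * sqrt ((Y - s)\<^sup>2 + (2 * b * y2)\<^sup>2))
                    / (4 * y1 * s * y3)"
    proof (intro divide_right_mono)
      have "4 * a * b * s - (X - s) * (Y - s) = (s - X) * (Y - s) + (2 * a * y2) * (2 * b * y2)"
        by (simp add: s_def power2_eq_square algebra_simps)
      also have "\<dots> \<le> sqrt ((s - X)\<^sup>2 + (2 * a * y2)\<^sup>2) * sqrt ((Y - s)\<^sup>2 + (2 * b * y2)\<^sup>2)"
      proof (rule power2_le_imp_le)
        let ?u = "s - X" and ?v = "2 * a * y2" and ?w = "Y - s" and ?z = "2 * b * y2"
        have "(?u\<^sup>2 + ?v\<^sup>2) * (?w\<^sup>2 + ?z\<^sup>2) - (?u * ?w + ?v * ?z)\<^sup>2 = (?u * ?z - ?v * ?w)\<^sup>2"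
          by (simp add: power2_eq_square algebra_simps)
        then have "(?u * ?w + ?v * ?z)\<^sup>2 \<le> (?u\<^sup>2 + ?v\<^sup>2) * (?w\<^sup>2 + ?z\<^sup>2)"
          by (metis diff_ge_0_iff_ge zero_le_power2)
        then show "(?u * ?w + ?v * ?z)\<^sup>2 \<le> (sqrt (?u\<^sup>2 + ?v\<^sup>2) * sqrt (?w\<^sup>2 + ?z\<^sup>2))\<^sup>2"
          by (simp add: power_mult_distrib)
      qed auto
      finally show "(X + s) * (Y + s) + 4 * a * b * s - (X - s) * (Y - s)
          \<le> (X + s) * (Y + s) + sqrt ((X - s)\<^sup>2 + (2 * a * y2)\<^sup>2) * sqrt ((Y - s)\<^sup>2 + (2 * b * y2)\<^sup>2)"
        by (simp add: power2_commute)
    qed (use * in \<open>auto simp: s_def\<close>)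
    also have "\<dots> = P * Q + sqrt (P\<^sup>2 - 1) * sqrt (Q\<^sup>2 - 1)"
      unfolding sP sQ unfolding P Q by (rule alg) simp
    also have "\<dots> = cosh (arcosh P + arcosh Q)"
      using PQT by (simp add: cosh_add sinh_arcosh_real)
    finally have "arcosh T \<le> arcosh (cosh (arcosh P + arcosh Q))"
      using PQT by (simp add: cosh_real_ge_1 leD leI)
    also have "\<dots> = arcosh P + arcosh Q"
      using PQT by (intro arcosh_cosh_real) (auto intro: add_nonneg_nonneg)
    finally have "c * arcosh T \<le> c * (arcosh P + arcosh Q)"
      using \<open>c > 0\<close> by simp
    then show "half_space_dist c dN p r \<le> half_space_dist c dN p q + half_space_dist c dN q r"
      by (simp add: * p q r half_space_dist_def P_def Q_def T_def a_def b_def distrib_left)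
  qed (use ge1 \<open>c > 0\<close> in \<open>auto simp: half_space_dist_def half_space_def\<close>)
qed


text \<open>Only the positivity and finiteness of the measure of balls is used for separability.\<close>

lemma doubling_separable:
  assumes "metric_measure_space N dN \<mu>" "doubling N dN \<mu>"
  obtains D where "countable D" "D \<subseteq> N"
    "\<And>x e. x \<in> N \<Longrightarrow> e > 0 \<Longrightarrow> \<exists>y\<in>D. dN x y < e"
proof -
  interpret metric_measure_space N dN \<mu> by fact
  have ball_sets: "mball x r \<in> sets \<mu>" for x r
  proof -
    have "{U. openin mtopology U} \<subseteq> Pow N" using openin_mtopology by auto
    then show ?thesis using openin_mball by (auto simp: sets_mu)
  qed
  have fin: "emeasure \<mu> (mball x r) < \<infinity>" and pos: "0 < emeasure \<mu> (mball x r)"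
    if "x \<in> N" "r > 0" for x r
    using assms(2) that unfolding doubling_def by blast+
  have ex: "\<exists>A. countable A \<and> A \<subseteq> N \<and> (\<forall>x\<in>N. \<exists>y\<in>A. dN x y < e)" if "e > 0" for e
  proof -
    define \<A> where "\<A> = {A. A \<subseteq> N \<and> pairwise (\<lambda>a b. e \<le> dN a b) A}"
    have "\<exists>A\<in>\<A>. \<forall>B\<in>\<A>. A \<subseteq> B \<longrightarrow> B = A"
    proof (rule subset_Zorn')
      fix C assume C: "subset.chain \<A> C"
      have sub: "X \<in> \<A>" if "X \<in> C" for X
        using C that by (auto simp: subset_chain_def)
      have tot: "X \<subseteq> Y \<or> Y \<subseteq> X" if "X \<in> C" "Y \<in> C" for X Y
        using C that unfolding subset_chain_def by blast
      have "e \<le> dN a b" if "a \<in> X" "X \<in> C" "b \<in> Y" "Y \<in> C" "a \<noteq> b" for a b X Y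
        using tot[of X Y] sub[of X] sub[of Y] that unfolding \<A>_def pairwise_def by auto
      then have "pairwise (\<lambda>a b. e \<le> dN a b) (\<Union>C)"
        unfolding pairwise_def by (metis UnionE)
      moreover have "\<Union>C \<subseteq> N" using sub by (auto simp: \<A>_def)
      ultimately show "\<Union>C \<in> \<A>" by (simp add: \<A>_def)
    qed
    then obtain A where A: "A \<subseteq> N" "\<And>a b. a \<in> A \<Longrightarrow> b \<in> A \<Longrightarrow> a \<noteq> b \<Longrightarrow> e \<le> dN a b"
      and max: "\<And>B. B \<in> \<A> \<Longrightarrow> A \<subseteq> B \<Longrightarrow> B = A"
      by (auto simp: \<A>_def pairwise_def)
    have "\<exists>y\<in>A. dN x y < e" if "x \<in> N" for x
    proof (rule ccontr)
      assume *: "\<not> (\<exists>y\<in>A. dN x y < e)"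
      then have "insert x A \<in> \<A>"
        using A that by (auto simp: \<A>_def pairwise_def commute not_less)
      then have "x \<in> A" using max by blast
      then show False using * that \<open>e > 0\<close> by auto
    qed
    moreover have "countable A"
    proof (cases "A = {}")
      case False
      then obtain x0 where x0: "x0 \<in> A" by blast
      have "countable (A \<inter> mball x0 (real n))" for n
      proof -
        let ?A = "A \<inter> mball x0 (real n)"
        let ?f = "\<lambda>a. measure \<mu> (mball a (e / 2))"
        have "sum ?f F \<le> measure \<mu> (mball x0 (real n + e))" if F: "F \<subseteq> ?A" "finite F" for F
        proof -
          have sub: "(\<Union>a\<in>F. mball a (e / 2)) \<subseteq> mball x0 (real n + e)"
          proof
            fix z assume "z \<in> (\<Union>a\<in>F. mball a (e / 2))"
            then obtain a where "a \<in> F" "a \<in> N" "z \<in> N" "dN a z < e / 2" by auto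
            moreover have "dN x0 a < real n" using F \<open>a \<in> F\<close> by auto
            ultimately show "z \<in> mball x0 (real n + e)"
              using triangle[of x0 a z] x0 A \<open>e > 0\<close> by auto
          qed
          have "disjoint_family_on (\<lambda>a. mball a (e / 2)) F"
            unfolding disjoint_family_on_def
          proof (intro ballI impI)
            fix a b assume ab: "a \<in> F" "b \<in> F" "a \<noteq> b"
            then have "e \<le> dN a b" "a \<in> N" "b \<in> N" using F A by auto
            then show "mball a (e / 2) \<inter> mball b (e / 2) = {}"
              using triangle[of a _ b] by (force simp: commute)
          qed
          moreover have "emeasure \<mu> (mball a (e / 2)) \<noteq> \<infinity>" if "a \<in> F" for a
            using fin[of a "e / 2"] that F A \<open>e > 0\<close> by auto
          ultimately have "sum ?f F = measure \<mu> (\<Union>a\<in>F. mball a (e / 2))"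
            using F ball_sets by (intro measure_finite_Union[symmetric]) auto
          also have "\<dots> \<le> measure \<mu> (mball x0 (real n + e))"
            using sub ball_sets fin[of x0 "real n + e"] x0 A \<open>e > 0\<close> F
            by (intro measure_mono_fmeasurable) (auto simp: fmeasurable_def)
          finally show ?thesis .
        qed
        then have "?f summable_on ?A"
          by (intro nonneg_bdd_above_summable_on) (auto intro!: bdd_aboveI2)
        then have "countable {a \<in> ?A. ?f a \<noteq> 0}" by (rule summable_countable_real)
        moreover have "{a \<in> ?A. ?f a \<noteq> 0} = ?A"
        proof -
          have "?f a \<noteq> 0" if "a \<in> ?A" for a
            using pos[of a "e / 2"] fin[of a "e / 2"] that A \<open>e > 0\<close>
            by (auto simp: measure_def enn2real_eq_0_iff)
          then show ?thesis by blast
        qed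
        ultimately show ?thesis by simp
      qed
      moreover have "A = (\<Union>n. A \<inter> mball x0 (real n))"
        using A x0 reals_Archimedean2 by fastforce
      ultimately show ?thesis by (metis countable_UN countableI_type)
    qed auto
    ultimately show ?thesis using A by blast
  qed
  define A where "A = (\<lambda>n. SOME A. countable A \<and> A \<subseteq> N \<and> (\<forall>x\<in>N. \<exists>y\<in>A. dN x y < 1 / Suc n))"
  have A: "countable (A n)" "A n \<subseteq> N" "\<And>x. x \<in> N \<Longrightarrow> \<exists>y\<in>A n. dN x y < 1 / Suc n" for n
    using someI_ex[OF ex[of "1 / Suc n"]] unfolding A_def by auto
  show ?thesis
  proof (rule that[of "\<Union>n. A n"])
    fix x e assume "x \<in> N" "(e::real) > 0"
    obtain n where "1 / Suc n < e" using nat_approx_posE \<open>e > 0\<close> by blast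
    then show "\<exists>y\<in>\<Union>n. A n. dN x y < e"
      using A(3)[OF \<open>x \<in> N\<close>, of n] by (force intro: less_trans)
  qed (use A in auto)
qed

lemma half_space_metric_measure_space:
  assumes "metric_measure_space N dN \<mu>" "doubling N dN \<mu>" "0 < c"
  shows "metric_measure_space (half_space N) (half_space_dist c dN) (half_space_measure \<mu>)"
proof -
  interpret N: metric_measure_space N dN \<mu> by fact
  interpret S: Metric_space "half_space N" "half_space_dist c dN"
    by (rule half_space_metric) (use assms N.Metric_space_axioms in auto)
  let ?S = "half_space N" and ?d = "half_space_dist c dN"
  have less_iff: "?d (x, y) (x', y') < e \<longleftrightarrow>
      (dN x x')\<^sup>2 + (y - y')\<^sup>2 < 2 * y * y' * (cosh (e / c) - 1)"
    if "y > 0" "y' > 0" "e > 0" for x y x' y' e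
  proof -
    let ?t = "((dN x x')\<^sup>2 + (y - y')\<^sup>2) / (2 * y * y')"
    have t: "?t \<ge> 0" using that by simp
    have "?d (x, y) (x', y') < e \<longleftrightarrow> arcosh (1 + ?t) < arcosh (cosh (e / c))"
      using that \<open>c > 0\<close> by (simp add: half_space_dist_def arcosh_cosh_real field_simps)
    also have "\<dots> \<longleftrightarrow> 1 + ?t < cosh (e / c)"
      using t by (intro arcosh_less_iff_real) (auto simp: cosh_real_ge_1)
    also have "\<dots> \<longleftrightarrow> ?t < cosh (e / c) - 1" by auto
    also have "\<dots> \<longleftrightarrow> (dN x x')\<^sup>2 + (y - y')\<^sup>2 < 2 * y * y' * (cosh (e / c) - 1)"
      using that by (simp add: divide_less_eq mult_ac)
    finally show ?thesis .
  qed
  have memS: "(x, y) \<in> ?S \<longleftrightarrow> x \<in> N \<and> y > 0" for x y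
    by (auto simp: half_space_def)
  have ch: "cosh (e / c) > 1" if "e > 0" for e
    using that \<open>c > 0\<close> by (simp add: cosh_real_nonneg_less_iff[of 0, simplified])
  have near1: "\<exists>r>0. \<forall>x' y'. x' \<in> N \<longrightarrow> y' > 0 \<longrightarrow> ?d (x, y) (x', y') < r \<longrightarrow>
                  dN x x' < e \<and> \<bar>y - y'\<bar> < e"
    if "x \<in> N" "y > 0" "e > 0" for x y e
  proof -
    define t where "t = min (1 / 4) (e\<^sup>2 / (4 * y\<^sup>2))"
    have t: "0 < t" "t \<le> 1 / 4" "4 * y\<^sup>2 * t \<le> e\<^sup>2"
      using that by (auto simp: t_def min_def field_simps)
    define r where "r = c * arcosh (1 + t)"
    have r: "r > 0" "cosh (r / c) - 1 = t"
      using t \<open>c > 0\<close> by (auto simp: r_def)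
    show ?thesis
    proof (intro exI conjI allI impI)
      fix x' y' assume *: "x' \<in> N" "0 < y'" "?d (x, y) (x', y') < r"
      then have l: "(dN x x')\<^sup>2 + (y - y')\<^sup>2 < 2 * y * y' * t"
        using less_iff[of y y' r x x'] r that by simp
      have "(y - y')\<^sup>2 \<le> 2 * y * y' * (1 / 4)"
        using l t mult_left_mono[of t "1/4" "2 * y * y'"] that * 
        by (smt (verit) mult_pos_pos zero_le_power2)
      then have y': "y' \<le> 2 * y"
      proof (rule contrapos_pp)
        assume "\<not> y' \<le> 2 * y"
        then have "(y' / 2) * (y' / 2) < (y' - y) * (y' - y)"
          using that by (intro mult_strict_mono) auto
        moreover have "2 * y * y' \<le> y' * y'"
          using \<open>\<not> y' \<le> 2 * y\<close> * by (intro mult_right_mono) auto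
        ultimately show "\<not> (y - y')\<^sup>2 \<le> 2 * y * y' * (1 / 4)"
          by (simp add: power2_eq_square algebra_simps)
      qed
      have "2 * y * y' * t \<le> 2 * y * (2 * y) * t"
        using y' that t by (intro mult_right_mono mult_left_mono) auto
      also have "\<dots> \<le> e\<^sup>2" using t by (simp add: power2_eq_square)
      finally have l: "(dN x x')\<^sup>2 + (y - y')\<^sup>2 < e\<^sup>2" using l by simp
      then have "(dN x x')\<^sup>2 < e\<^sup>2" and ye: "\<bar>y - y'\<bar>\<^sup>2 < e\<^sup>2"
        using zero_le_power2[of "dN x x'"] zero_le_power2[of "y - y'"] unfolding power2_abs by linarith+
      then show "dN x x' < e" "\<bar>y - y'\<bar> < e"
        using that power_less_imp_less_base[OF ye] by (auto intro: power_less_imp_less_base)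
    qed (use r in auto)
  qed
  have near2: "\<exists>r>0. \<forall>x' y'. x' \<in> N \<longrightarrow> y' > 0 \<longrightarrow> dN x x' < r \<longrightarrow> \<bar>y - y'\<bar> < r \<longrightarrow>
                  ?d (x, y) (x', y') < e"
    if "x \<in> N" "y > 0" "e > 0" for x y e
  proof -
    define t where "t = cosh (e / c) - 1"
    have t: "t > 0" using ch[OF \<open>e > 0\<close>] by (simp add: t_def)
    define r where "r = min (y / 2) (y * sqrt (t / 2))"
    have r: "r > 0" "r \<le> y / 2" "r \<le> y * sqrt (t / 2)" using that t by (auto simp: r_def)
    have "r\<^sup>2 \<le> (y * sqrt (t / 2))\<^sup>2" using r by (intro power_mono) auto
    then have r2: "2 * r\<^sup>2 \<le> y\<^sup>2 * t" using t by (simp add: power_mult_distrib)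
    show ?thesis
    proof (intro exI conjI allI impI)
      fix x' y' assume *: "x' \<in> N" "0 < y'" "dN x x' < r" "\<bar>y - y'\<bar> < r"
      have "(dN x x')\<^sup>2 < r\<^sup>2" using * by (intro power_strict_mono) auto
      moreover have "(y - y')\<^sup>2 < r\<^sup>2" using * power_strict_mono[of "\<bar>y - y'\<bar>" r 2] by simp
      ultimately have "(dN x x')\<^sup>2 + (y - y')\<^sup>2 < y\<^sup>2 * t" using r2 by linarith
      also have "\<dots> \<le> 2 * y * y' * t"
      proof -
        have "y * y \<le> y * (2 * y')" using * r that by (intro mult_left_mono) auto
        then show ?thesis using t by (auto intro!: mult_right_mono simp: power2_eq_square)
      qed
      finally show "?d (x, y) (x', y') < e"
        using less_iff[of y y' e x x'] * that by (simp add: t_def)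
    qed (use r in auto)
  qed
  obtain D where D: "countable D" "D \<subseteq> N" "\<And>x e. x \<in> N \<Longrightarrow> e > 0 \<Longrightarrow> \<exists>y\<in>D. dN x y < e"
    using doubling_separable assms by metis
  have openS: "openin S.mtopology U \<longleftrightarrow> U \<subseteq> ?S \<and> (\<forall>p. p \<in> U \<longrightarrow> (\<exists>r>0. S.mball p r \<subseteq> U))" for U
    by (rule S.openin_mtopology)
  let ?P = "half_space_measure \<mu>"
  let ?B = "borel_alg ?S ?d"
  have spP: "space ?P = ?S"
    by (simp add: half_space_measure_def space_pair_measure N.space_mu half_space_def
        space_restrict_space)
  have spB: "space ?B = ?S"
    by (simp add: space_measure_of_conv)
  have spN: "Pow N \<supseteq> {U. openin N.mtopology U}" using N.openin_mtopology by auto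
  have spS: "Pow ?S \<supseteq> {U. openin S.mtopology U}" using S.openin_mtopology by auto
  have ballN: "N.mball x r \<in> sets \<mu>" for x r
    using spN N.openin_mball by (auto simp: N.sets_mu)
  let ?R = "restrict_space borel {0<..} :: real measure"
  have setsP: "sets ?P = sets (borel_alg N dN \<Otimes>\<^sub>M ?R)"
    unfolding half_space_measure_def
    by (intro sets_pair_measure_cong) (auto simp: N.sets_mu sets_restrict_space)
  have idm: "id \<in> measurable ?B (borel_alg N dN \<Otimes>\<^sub>M ?R)"
  proof (rule measurable_pair)
    have "fst \<in> measurable ?B (borel_alg N dN)"
    proof (rule measurable_sigma_sets)
      show "sets (borel_alg N dN) = sigma_sets N {U. openin N.mtopology U}"
        using spN by simp
      fix U assume "U \<in> {U. openin N.mtopology U}"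
      then have U: "openin N.mtopology U" by simp
      have "openin S.mtopology (fst -` U \<inter> ?S)"
        unfolding openS
      proof (intro conjI allI impI)
        fix p assume "p \<in> fst -` U \<inter> ?S"
        then obtain x y where p: "p = (x, y)" "x \<in> U" "y > 0" "x \<in> N"
          by (auto simp: half_space_def)
        obtain e where e: "e > 0" "N.mball x e \<subseteq> U"
          using U p(2) by (auto simp: N.openin_mtopology)
        obtain r where "r > 0" "\<And>x' y'. x' \<in> N \<Longrightarrow> y' > 0 \<Longrightarrow> ?d (x, y) (x', y') < r \<Longrightarrow> dN x x' < e"
          using near1[OF p(4) p(3) e(1)] by blast
        then show "\<exists>r>0. S.mball p r \<subseteq> fst -` U \<inter> ?S"
          using e p by (intro exI[of _ r]) (auto simp: memS subset_iff)
      qed auto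
      then show "fst -` U \<inter> space ?B \<in> sets ?B"
        using spS by (simp add: spB)
    qed (use spN in \<open>auto simp: spB memS\<close>)
    then show "fst \<circ> id \<in> measurable ?B (borel_alg N dN)" by simp
    have "snd \<in> borel_measurable ?B"
    proof (rule borel_measurableI)
      fix U :: "real set" assume U: "open U"
      have "openin S.mtopology (snd -` U \<inter> ?S)"
        unfolding openS
      proof (intro conjI allI impI)
        fix p assume "p \<in> snd -` U \<inter> ?S"
        then obtain x y where p: "p = (x, y)" "y \<in> U" "y > 0" "x \<in> N"
          by (auto simp: half_space_def)
        obtain e where e: "e > 0" "ball y e \<subseteq> U"
          using U p(2) openE by blast
        obtain r where "r > 0" "\<And>x' y'. x' \<in> N \<Longrightarrow> y' > 0 \<Longrightarrow> ?d (x, y) (x', y') < r \<Longrightarrow> \<bar>y - y'\<bar> < e"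
          using near1[OF p(4) p(3) e(1)] by blast
        then show "\<exists>r>0. S.mball p r \<subseteq> snd -` U \<inter> ?S"
          using e p by (intro exI[of _ r]) (auto simp: memS dist_real_def subset_iff)
      qed auto
      then show "snd -` U \<inter> space ?B \<in> sets ?B"
        using spS by (simp add: spB)
    qed
    then show "snd \<circ> id \<in> measurable ?B ?R"
      by (auto simp: spB memS intro!: measurable_restrict_space2)
  qed
  have "sets ?P \<subseteq> sets ?B"
  proof
    fix A assume A: "A \<in> sets ?P"
    then have "id -` A \<inter> space ?B \<in> sets ?B"
      using measurable_sets[OF idm] by (simp only: setsP)
    moreover have "id -` A \<inter> space ?B = A"
      using sets.sets_into_space[OF A] by (simp only: spP spB) auto
    ultimately show "A \<in> sets ?B" by (simp only:)
  qed
  moreover have "sets ?B \<subseteq> sets ?P"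
  proof -
    have "U \<in> sets ?P" if U: "openin S.mtopology U" for U
    proof -
      define box where "box = (\<lambda>(x, q, r). N.mball x r \<times> ({q - r<..<q + r} \<inter> {0<..}))"
      have box: "box i \<in> sets ?P" for i
      proof -
        obtain x q r where i: "i = (x, q, r)" by (cases i)
        have "{q - r<..<q + r} \<inter> {0<..} \<in> sets ?R"
          by (subst sets_restrict_space_iff) auto
        then show ?thesis
          unfolding i box_def half_space_measure_def using ballN
          by (simp add: sets_restrict_space pair_measureI)
      qed
      define I where "I = {i \<in> D \<times> \<rat> \<times> \<rat>. box i \<subseteq> U}"
      have "countable I"
        unfolding I_def using D countable_rat by (intro countable_Collect) auto
      moreover have "U = (\<Union>i\<in>I. box i)"
      proof
        show "U \<subseteq> (\<Union>i\<in>I. box i)"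
        proof
          fix p assume p: "p \<in> U"
          then have "p \<in> ?S" using U openS by blast
          then obtain x y where xy: "p = (x, y)" "x \<in> N" "y > 0"
            by (cases p) (auto simp: memS)
          obtain e where e: "e > 0" "S.mball p e \<subseteq> U" using U p openS by blast
          obtain r where r: "r > 0" "\<And>x' y'. x' \<in> N \<Longrightarrow> y' > 0 \<Longrightarrow> dN x x' < r \<Longrightarrow> \<bar>y - y'\<bar> < r \<Longrightarrow> ?d (x, y) (x', y') < e"
            using near2[OF xy(2,3) e(1)] by blast
          obtain s where s: "s \<in> \<rat>" "0 < s" "s < r / 2" 
            using Rats_dense_in_real[of 0 "r / 2"] r by auto
          obtain q where q: "q \<in> \<rat>" "y - s < q" "q < y"
            using Rats_dense_in_real[of "y - s" y] s by auto
          obtain z where z: "z \<in> D" "dN x z < s" using D(3)[OF xy(2) s(2)] by auto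
          have zN: "z \<in> N" using z D by auto
          have "box (z, q, s) \<subseteq> U"
          proof
            fix w assume "w \<in> box (z, q, s)"
            then obtain x' y' where w: "w = (x', y')" "x' \<in> N" "dN z x' < s" "y' > 0" "\<bar>q - y'\<bar> < s"
              by (auto simp: box_def)
            have "dN x x' < r" using N.triangle[OF xy(2) zN w(2)] w z s by linarith
            moreover have "\<bar>y - y'\<bar> < r" using w q s by linarith
            ultimately show "w \<in> U" using e r w xy \<open>p \<in> ?S\<close> by (auto simp: memS subset_iff)
          qed
          moreover have "p \<in> box (z, q, s)"
            using xy z zN q s by (auto simp: box_def N.commute)
          ultimately show "p \<in> (\<Union>i\<in>I. box i)" using z q s by (auto simp: I_def)
        qed
      qed (auto simp: I_def)
      ultimately show ?thesis
        using sets.countable_UN'[of I box ?P] box by auto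
    qed
    then have "sigma_sets (space ?P) {U. openin S.mtopology U} \<subseteq> sets ?P"
      by (intro sets.sigma_sets_subset) auto
    then show ?thesis using spS by (simp add: spP)
  qed
  ultimately show ?thesis
    by unfold_locales (auto simp: spP)
qed

end

(*
  Every nonempty vertical section of a ball of the half-space over N is an interval. A ball with
  center (x0, a0) lies over a ball of N, and vertical segments join its points, inside a comparable
  ball, to a slice N x {v} whose height v may be chosen in a fixed interval J of heights. Along these
  segments f is controlled by the vertical upper gradient and Hoelder's inequality, at the cost of
  the p-th power of the hyperbolic height of the ball, that is, R^p. On the slice the Poincare
  inequality of N applies, since (c / v) g(., v) is an upper gradient of f(., v); a mean value
  argument over J yields a height v at which the integral of g(., v)^p over the slice is controlled
  by the integral of g^p over the ball. For R <= c, J is the whole range of heights; for R >= c it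
  is the top unit of the logarithmic height.
*)

theory Submission
  imports Defs "HOL-Real_Asymp.Real_Asymp"
begin

text \<open>The obstacle is the exponential growth of horizontal sections: a ball of radius
  \<open>c * k\<close> lies over a base ball of radius \<open>r = a0 * sinh k\<close>. Measured at
  height \<open>v\<close> this radius is \<open>r * c / v\<close>, which is exponential in
  \<open>k\<close> for \<open>v\<close> near \<open>a0\<close> but bounded near the top height
  \<open>a0 * exp k\<close>; this is why large balls use slices near the top. The range of heights
  has logarithmic length \<open>2 * k\<close>, the interval of slices has length 1, and the
  resulting factor \<open>2 * k\<close> is absorbed by \<open>k powr p\<close>. The same growth
  yields the additive enlargement of the radius: near the top, a bounded increase of the radius
  widens the slices of a ball by any prescribed factor, in particular by \<Lambda>. The height
  cannot be fixed in advance, as Fubini's theorem makes \<open>f\<close> locally integrable on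
  almost every slice only. A second obstacle is the line integral, whose arclength parametrization
  is a choice function. Lengths of curves must therefore scale exactly when lifted to a slice, so
  that the choices agree, and the change of variables must do without measurability.\<close>

section \<open>Powers of nonnegative integrals\<close>

text \<open>Convexity: the graph of \<open>t powr p\<close> lies above its tangent at
  \<open>s\<close>. The arrangement keeps every term nonnegative, so that the inequality passes to
  \<open>ennreal\<close>. For \<open>p > 1\<close> it is Young's inequality; \<open>p = 1\<close>
  has no finite conjugate exponent.\<close>

lemma power_tangent_line:
  fixes p s t :: real
  assumes "1 \<le> p" "0 < s" "0 \<le> t"
  shows "p * s powr (p - 1) * t \<le> t powr p + (p - 1) * s powr p"
proof (cases "p = 1")
  case False
  then have p: "p > 1" using assms by simp
  define q where "q = p / (p - 1)"
  have q: "q > 1" "1 / p + 1 / q = 1" "(p - 1) * q = p" "p / q = p - 1"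
    using p by (auto simp: q_def field_simps)
  have "t * s powr (p - 1) \<le> t powr p / p + (s powr (p - 1)) powr q / q"
    using Youngs_inequality[of p q t "s powr (p - 1)"] p q assms by auto
  then have "p * (t * s powr (p - 1)) \<le> p * (t powr p / p + s powr p / q)"
    using p q by (intro mult_left_mono) (auto simp: powr_powr)
  also have "\<dots> = t powr p + p / q * s powr p"
    using p by (simp add: distrib_left)
  finally show ?thesis using q by (simp add: mult_ac)
qed (use assms in auto)

lemma ennreal_powr_ennreal [simp]: "0 \<le> x \<Longrightarrow> ennreal_powr (ennreal x) p = ennreal (x powr p)"
  by (simp add: ennreal_powr_def)

lemma ennreal_powr_top [simp]: "ennreal_powr \<infinity> p = \<infinity>" "ennreal_powr top p = top"
  by (simp_all add: ennreal_powr_def)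

lemma ennreal_powr_0 [simp]: "ennreal_powr 0 p = 0"
  by (simp add: ennreal_powr_def)

lemma borel_measurable_ennreal_powr [measurable (raw)]:
  assumes [measurable]: "h \<in> borel_measurable M"
  shows "(\<lambda>x. ennreal_powr (h x) p) \<in> borel_measurable M"
  unfolding ennreal_powr_def by measurable

lemma ennreal_powr_mono:
  assumes "a \<le> b" "0 \<le> p"
  shows "ennreal_powr a p \<le> ennreal_powr b p"
  using assms by (cases a; cases b) (auto intro!: ennreal_leI powr_mono2 simp: top_unique)

lemma ennreal_powr_mult:
  assumes "0 < k"
  shows "ennreal_powr (ennreal k * a) p = ennreal (k powr p) * ennreal_powr a p"
proof (cases a)
  case (real r)
  then show ?thesis using assms by (simp flip: ennreal_mult add: powr_mult)
qed (use assms in \<open>simp add: ennreal_mult_top\<close>)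

lemma ennreal_powr_indicator:
  "ennreal_powr (a * indicator A x) p = ennreal_powr a p * indicator A x"
  by (simp add: indicator_def)

lemma ennreal_powr_add_le:
  assumes "0 \<le> p"
  shows "ennreal_powr (a + b) p \<le> ennreal (2 powr p) * (ennreal_powr a p + ennreal_powr b p)"
proof -
  have "a + b \<le> ennreal 2 * max a b"
    using add_mono[of a "max a b" b "max a b"] by (simp add: mult_2)
  then have "ennreal_powr (a + b) p \<le> ennreal_powr (ennreal 2 * max a b) p"
    by (rule ennreal_powr_mono) fact
  also have "\<dots> = ennreal (2 powr p) * ennreal_powr (max a b) p"
    by (rule ennreal_powr_mult) simp
  also have "\<dots> \<le> ennreal (2 powr p) * (ennreal_powr a p + ennreal_powr b p)"
    by (intro mult_left_mono) (auto simp: max_def)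
  finally show ?thesis .
qed

text \<open>Hoelder's inequality against the constant 1, for \<open>ennreal\<close>-valued
  \<open>h\<close>. It results from integrating the tangent line of the power at \<open>s\<close>
  and then choosing \<open>s\<close> as the mean of \<open>h\<close>, with \<open>m\<close> in place
  of the measure of \<open>A\<close>.\<close>

lemma nn_integral_powr_le:
  assumes [measurable]: "h \<in> borel_measurable M" "A \<in> sets M"
    and p: "1 \<le> p" and m: "0 < m" "emeasure M A \<le> ennreal m"
  shows "ennreal_powr (\<integral>\<^sup>+x\<in>A. h x \<partial>M) p \<le> ennreal (m powr (p - 1)) * (\<integral>\<^sup>+x\<in>A. ennreal_powr (h x) p \<partial>M)"
proof -
  let ?I = "\<integral>\<^sup>+x\<in>A. h x \<partial>M" and ?X = "\<integral>\<^sup>+x\<in>A. ennreal_powr (h x) p \<partial>M"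
  have tangent: "ennreal (p * s powr (p - 1)) * ?I \<le> ?X + ennreal ((p - 1) * s powr p * m)" if "s > 0" for s
  proof -
    have pt: "ennreal (p * s powr (p - 1)) * a \<le> ennreal_powr a p + ennreal ((p - 1) * s powr p)" for a
      using power_tangent_line[OF p that] p that
      by (cases a) (auto simp flip: ennreal_mult ennreal_plus intro!: ennreal_leI)
    have "ennreal (p * s powr (p - 1)) * ?I = (\<integral>\<^sup>+x. ennreal (p * s powr (p - 1)) * (h x * indicator A x) \<partial>M)"
      by (rule nn_integral_cmult[symmetric]) measurable
    also have "\<dots> \<le> (\<integral>\<^sup>+x. ennreal_powr (h x) p * indicator A x + ennreal ((p - 1) * s powr p) * indicator A x \<partial>M)"
      by (intro nn_integral_mono) (use pt in \<open>auto simp: indicator_def\<close>)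
    also have "\<dots> = ?X + ennreal ((p - 1) * s powr p) * emeasure M A"
      by (subst nn_integral_add) (auto simp: nn_integral_cmult)
    also have "\<dots> \<le> ?X + ennreal ((p - 1) * s powr p) * ennreal m"
      using m by (intro add_left_mono mult_left_mono) auto
    finally show ?thesis using p m by (simp add: ennreal_mult)
  qed
  show ?thesis
  proof (cases ?I)
    case top
    then have "?X + ennreal ((p - 1) * m) = top"
      using tangent[of 1] p by (simp add: ennreal_mult_top top_unique)
    then have "?X = top" by simp
    then show ?thesis using m by (simp add: ennreal_mult_top)
  next
    case (real r)
    show ?thesis
    proof (cases "r = 0 \<or> ?X = top")
      case True
      then show ?thesis using real m by (auto simp: ennreal_mult_top)
    next
      case False
      then obtain X where X: "?X = ennreal X" "0 \<le> X" by (cases ?X) auto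
      \<comment> \<open>At this tangent point \<open>s powr p * m\<close> equals
        \<open>s powr (p - 1) * r\<close>, so the tangent inequality collapses to
        \<open>s powr (p - 1) * r \<le> X\<close>.\<close>
      define s where "s = r / m"
      have s: "s > 0" "r = s * m" using False real m by (auto simp: s_def)
      have sp: "s powr p = s powr (p - 1) * s"
        using powr_mult_base[of s "p - 1"] s by (simp add: mult.commute)
      have "p * s powr (p - 1) * r \<le> X + (p - 1) * s powr p * m"
        using tangent[OF s(1)] X real p m by (simp flip: ennreal_mult ennreal_plus)
      then have "s powr (p - 1) * r \<le> X"
        by (simp add: sp s(2) algebra_simps)
      then have "m powr (p - 1) * (s powr (p - 1) * r) \<le> m powr (p - 1) * X"
        by (intro mult_left_mono) auto
      moreover have "r powr p = m powr (p - 1) * (s powr (p - 1) * r)"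
        using s m powr_mult_base[of r "p - 1"] False real by (simp add: powr_mult mult_ac)
      ultimately show ?thesis using real X by (simp flip: ennreal_mult)
    qed
  qed
qed

text \<open>The mean is an optimal constant up to a factor, because by Hoelder's inequality the
  distance from \<kappa> to the mean is controlled by the integral on the right. This allows the
  mean over a ball of the half-space to be exchanged for the mean over a slice.\<close>

lemma nn_integral_mean_value_le:
  fixes f :: "'a \<Rightarrow> real"
  assumes B: "B \<in> sets M" "emeasure M B < \<infinity>" and f: "set_integrable M B f" and p: "1 \<le> p"
  shows "(\<integral>\<^sup>+z\<in>B. ennreal (\<bar>f z - mean_value M B f\<bar> powr p) \<partial>M)
    \<le> ennreal (2 * 2 powr p) * (\<integral>\<^sup>+z\<in>B. ennreal (\<bar>f z - \<kappa>\<bar> powr p) \<partial>M)"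
proof (cases "measure M B = 0")
  case True
  then have "B \<in> null_sets M" using B by (auto simp: null_sets_def measure_def enn2real_eq_0_iff)
  then have "AE z in M. ennreal (\<bar>f z - mean_value M B f\<bar> powr p) * indicator B z = 0"
    by (auto simp: indicator_def dest!: AE_not_in elim!: eventually_mono)
  then have "(\<integral>\<^sup>+z\<in>B. ennreal (\<bar>f z - mean_value M B f\<bar> powr p) \<partial>M) = (\<integral>\<^sup>+z. 0 \<partial>M)"
    by (rule nn_integral_cong_AE)
  then show ?thesis by simp
next
  case False
  define m where "m = measure M B"
  have m: "m > 0" "emeasure M B = ennreal m"
    using False B by (auto simp: m_def emeasure_eq_ennreal_measure zero_less_measure_iff)
  \<comment> \<open>Measurability of \<open>f\<close> is known on \<open>B\<close> only; the cutoff
    makes the difference integrable on the whole space.\<close>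
  define h where "h z = f z * indicator B z - \<kappa> * indicator B z" for z
  have [measurable]: "(\<lambda>z. f z * indicator B z) \<in> borel_measurable M" "B \<in> sets M"
    using f B by (auto simp: set_integrable_def mult.commute)
  have int: "integrable M (\<lambda>z. f z * indicator B z)" "integrable M (\<lambda>z. \<kappa> * indicator B z)"
    using f B by (auto simp: set_integrable_def mult.commute)
  then have inth: "integrable M h" unfolding h_def by (rule Bochner_Integration.integrable_diff)
  let ?a = "mean_value M B f" and ?X = "\<integral>\<^sup>+z\<in>B. ennreal (\<bar>f z - \<kappa>\<bar> powr p) \<partial>M"
  have "integral\<^sup>L M h = (LINT z:B|M. f z) - \<kappa> * m"
    unfolding h_def using int B by (simp add: set_lebesgue_integral_def mult.commute m_def)
  then have "?a - \<kappa> = (1 / m) * integral\<^sup>L M h"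
    using m by (simp add: mean_value_def m_def field_simps)
  then have "\<bar>?a - \<kappa>\<bar> = (1 / m) * \<bar>integral\<^sup>L M h\<bar>" using m by (simp add: abs_mult)
  also have "\<dots> \<le> (1 / m) * (LINT z|M. \<bar>h z\<bar>)"
    using m by (intro mult_left_mono integral_abs_bound) auto
  finally have "ennreal \<bar>?a - \<kappa>\<bar> \<le> ennreal ((1 / m) * (LINT z|M. \<bar>h z\<bar>))"
    by (rule ennreal_leI)
  also have "\<dots> = ennreal (1 / m) * (\<integral>\<^sup>+z. ennreal \<bar>h z\<bar> \<partial>M)"
    using m inth by (subst nn_integral_eq_integral) (auto intro: ennreal_mult simp del: times_divide_eq_left)
  also have "(\<integral>\<^sup>+z. ennreal \<bar>h z\<bar> \<partial>M) = (\<integral>\<^sup>+z\<in>B. ennreal \<bar>h z\<bar> \<partial>M)"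
    by (intro nn_integral_cong) (auto simp: h_def indicator_def)
  finally have "ennreal_powr (ennreal \<bar>?a - \<kappa>\<bar>) p \<le> ennreal_powr (ennreal (1 / m) * (\<integral>\<^sup>+z\<in>B. ennreal \<bar>h z\<bar> \<partial>M)) p"
    using p by (intro ennreal_powr_mono) auto
  also have "\<dots> = ennreal ((1 / m) powr p) * ennreal_powr (\<integral>\<^sup>+z\<in>B. ennreal \<bar>h z\<bar> \<partial>M) p"
    using m by (intro ennreal_powr_mult) auto
  also have "\<dots> \<le> ennreal ((1 / m) powr p) * (ennreal (m powr (p - 1)) * (\<integral>\<^sup>+z\<in>B. ennreal_powr (ennreal \<bar>h z\<bar>) p \<partial>M))"
    using m p B inth by (intro mult_left_mono nn_integral_powr_le) auto
  also have "(\<integral>\<^sup>+z\<in>B. ennreal_powr (ennreal \<bar>h z\<bar>) p \<partial>M) = ?X"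
    by (intro nn_integral_cong) (auto simp: h_def indicator_def)
  also have "ennreal ((1 / m) powr p) * (ennreal (m powr (p - 1)) * ?X) = ennreal (1 / m) * ?X"
  proof -
    have "(1 / m) powr p * m powr (p - 1) = 1 / m"
      using m by (simp add: powr_divide powr_diff)
    then show ?thesis using m by (simp flip: ennreal_mult mult.assoc)
  qed
  finally have jensen: "ennreal (\<bar>?a - \<kappa>\<bar> powr p) \<le> ennreal (1 / m) * ?X" by simp
  have "(\<integral>\<^sup>+z\<in>B. ennreal (\<bar>f z - ?a\<bar> powr p) \<partial>M)
    \<le> (\<integral>\<^sup>+z. ennreal (2 powr p) * (ennreal (\<bar>h z\<bar> powr p) * indicator B z + ennreal (\<bar>?a - \<kappa>\<bar> powr p) * indicator B z) \<partial>M)"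
  proof (intro nn_integral_mono)
    fix z
    have "ennreal_powr (ennreal \<bar>f z - ?a\<bar>) p \<le> ennreal_powr (ennreal \<bar>f z - \<kappa>\<bar> + ennreal \<bar>?a - \<kappa>\<bar>) p"
      using p by (intro ennreal_powr_mono) (auto simp flip: ennreal_plus)
    also have "\<dots> \<le> ennreal (2 powr p) * (ennreal (\<bar>f z - \<kappa>\<bar> powr p) + ennreal (\<bar>?a - \<kappa>\<bar> powr p))"
      using p ennreal_powr_add_le[of p "ennreal \<bar>f z - \<kappa>\<bar>" "ennreal \<bar>?a - \<kappa>\<bar>"] by simp
    finally show "ennreal (\<bar>f z - ?a\<bar> powr p) * indicator B z
      \<le> ennreal (2 powr p) * (ennreal (\<bar>h z\<bar> powr p) * indicator B z + ennreal (\<bar>?a - \<kappa>\<bar> powr p) * indicator B z)"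
      by (auto simp: indicator_def h_def)
  qed
  also have "\<dots> = ennreal (2 powr p) * ((\<integral>\<^sup>+z\<in>B. ennreal (\<bar>h z\<bar> powr p) \<partial>M) + ennreal (\<bar>?a - \<kappa>\<bar> powr p) * emeasure M B)"
    using inth B by (subst nn_integral_cmult) (auto simp: nn_integral_add nn_integral_cmult)
  also have "(\<integral>\<^sup>+z\<in>B. ennreal (\<bar>h z\<bar> powr p) \<partial>M) = ?X"
    by (intro nn_integral_cong) (auto simp: h_def indicator_def)
  also have "ennreal (2 powr p) * (?X + ennreal (\<bar>?a - \<kappa>\<bar> powr p) * emeasure M B)
      \<le> ennreal (2 powr p) * (?X + ennreal (1 / m) * ?X * ennreal m)"
    using jensen by (intro mult_left_mono add_left_mono) (auto simp: m intro: mult_right_mono)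
  also have "ennreal (1 / m) * ?X * ennreal m = (ennreal (1 / m) * ennreal m) * ?X"
    by (simp only: mult_ac)
  also have "ennreal (1 / m) * ennreal m = 1"
    using m by (simp flip: ennreal_mult)
  also have "ennreal (2 powr p) * (?X + 1 * ?X) = ennreal (2 * 2 powr p) * ?X"
    by (simp add: ennreal_mult mult_ac flip: mult_2)
  finally show ?thesis .
qed

text \<open>
  No measurability is assumed: the arclength parametrization in a line integral is a choice function.
\<close>

lemma nn_integral_lborel_scale_le:
  fixes h :: "real \<Rightarrow> ennreal"
  assumes "0 < k"
  shows "(\<integral>\<^sup>+s. h s \<partial>lborel) \<le> (\<integral>\<^sup>+s. ennreal k * h (k * s) \<partial>lborel)"
proof -
  \<comment> \<open>The nonnegative integral is a supremum over simple functions below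
    \<open>h\<close>; these are measurable, so the affine substitution applies to each of
    them.\<close>
  have "integral\<^sup>S lborel \<phi> \<le> (\<integral>\<^sup>+s. ennreal k * h (k * s) \<partial>lborel)"
    if \<phi>: "simple_function lborel \<phi>" "\<phi> \<le> h" for \<phi>
  proof -
    have [measurable]: "\<phi> \<in> borel_measurable borel"
      using borel_measurable_simple_function[OF \<phi>(1)] by simp
    have "integral\<^sup>S lborel \<phi> = (\<integral>\<^sup>+s. \<phi> s \<partial>lborel)"
      using \<phi> by (simp add: nn_integral_eq_simple_integral)
    also have "\<dots> = ennreal k * (\<integral>\<^sup>+s. \<phi> (k * s) \<partial>lborel)"
      using nn_integral_real_affine[of \<phi> k 0] assms by simp
    also have "\<dots> = (\<integral>\<^sup>+s. ennreal k * \<phi> (k * s) \<partial>lborel)"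
      by (rule nn_integral_cmult[symmetric]) measurable
    also have "\<dots> \<le> (\<integral>\<^sup>+s. ennreal k * h (k * s) \<partial>lborel)"
      using \<phi> by (intro nn_integral_mono mult_left_mono) (auto simp: le_fun_def)
    finally show ?thesis .
  qed
  then show ?thesis unfolding nn_integral_def by (intro SUP_least) auto
qed

section \<open>Lengths of curves\<close>

text \<open>A lower bound for the length, witnessed by a single partition. In this form lower bounds
  are real numbers that add up under concatenation, which suits an induction by bisection.\<close>

definition partition_sum_ge :: "('a \<Rightarrow> 'a \<Rightarrow> real) \<Rightarrow> (real \<Rightarrow> 'a) \<Rightarrow> real \<Rightarrow> real \<Rightarrow> real \<Rightarrow> bool" where
  "partition_sum_ge d \<gamma> a b v \<longleftrightarrow>
     (\<exists>n t. t (0::nat) = a \<and> t n = b \<and> mono_on {..n} t \<and> v \<le> (\<Sum>i<n. d (\<gamma> (t i)) (\<gamma> (t (Suc i)))))"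

lemma partition_sum_ge_mono: "partition_sum_ge d \<gamma> a b v \<Longrightarrow> w \<le> v \<Longrightarrow> partition_sum_ge d \<gamma> a b w"
  unfolding partition_sum_ge_def by (blast intro: order_trans)

lemma partition_sum_ge_refl: "partition_sum_ge d \<gamma> a a 0"
  unfolding partition_sum_ge_def by (intro exI[of _ 0] exI[of _ "\<lambda>_. a"]) (simp add: mono_on_def)

lemma partition_sum_ge_dist: "a \<le> b \<Longrightarrow> partition_sum_ge d \<gamma> a b (d (\<gamma> a) (\<gamma> b))"
  unfolding partition_sum_ge_def
  by (intro exI[of _ 1] exI[of _ "\<lambda>i. if i = 0 then a else b"]) (simp add: mono_on_def)

lemma partition_sum_ge_trans:
  assumes "partition_sum_ge d \<gamma> a b v" "partition_sum_ge d \<gamma> b e w"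
  shows "partition_sum_ge d \<gamma> a e (v + w)"
proof -
  let ?s = "\<lambda>t i. d (\<gamma> (t i)) (\<gamma> (t (Suc i)))"
  obtain n t where t: "t (0::nat) = a" "t n = b" "mono_on {..n} t" "v \<le> (\<Sum>i<n. ?s t i)"
    using assms(1) unfolding partition_sum_ge_def by blast
  obtain m u where u: "u (0::nat) = b" "u m = e" "mono_on {..m} u" "w \<le> (\<Sum>i<m. ?s u i)"
    using assms(2) unfolding partition_sum_ge_def by blast
  \<comment> \<open>Index \<open>n\<close> falls into the second branch; both partitions take the
    value \<open>b\<close> there.\<close>
  define r where "r i = (if i < n then t i else u (i - n))" for i
  have rt: "r i = t i" if "i \<le> n" for i
    using that t u by (cases "i = n") (auto simp: r_def)
  have ru: "r (n + i) = u i" for i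
    by (simp add: r_def)
  have ruS: "r (Suc (n + i)) = u (Suc i)" for i
    using ru[of "Suc i"] by simp
  have "mono_on {..n + m} r"
  proof (rule mono_onI)
    fix i j assume ij: "i \<in> {..n + m}" "j \<in> {..n + m}" "i \<le> j"
    consider "j \<le> n" | "i \<le> n" "n \<le> j" | "n \<le> i" using ij by linarith
    then show "r i \<le> r j"
    proof cases
      case 1
      then show ?thesis using ij t(3) by (simp add: rt mono_onD)
    next
      case 2
      have "t i \<le> t n" using t(3) 2 by (simp add: mono_onD)
      moreover have "u 0 \<le> u (j - n)" using u(3) ij 2 by (simp add: mono_onD)
      ultimately show ?thesis using 2 t u rt[of i] ru[of "j - n"] by simp
    next
      case 3
      have "u (i - n) \<le> u (j - n)" using u(3) ij 3 by (simp add: mono_onD)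
      then show ?thesis using 3 ij ru[of "j - n"] ru[of "i - n"] by simp
    qed
  qed
  moreover have "(\<Sum>i<n + m. ?s r i) = (\<Sum>i<n. ?s t i) + (\<Sum>i<m. ?s u i)"
  proof -
    have "(\<Sum>i<n + k. ?s r i) = (\<Sum>i<n. ?s r i) + (\<Sum>i<k. ?s u i)" for k
      by (induction k) (simp_all add: ru ruS)
    then show ?thesis by (simp add: rt)
  qed
  ultimately show ?thesis
    unfolding partition_sum_ge_def using t u rt[of 0] ru[of m]
    by (intro exI[of _ "n + m"] exI[of _ r]) auto
qed

lemma partition_sum_ge_curve_length:
  assumes "partition_sum_ge d \<gamma> a b v" "\<And>x y. 0 \<le> d x y"
  shows "ennreal v \<le> curve_length d \<gamma> a b"
proof -
  obtain n t where t: "t (0::nat) = a" "t n = b" "mono_on {..n} t" "v \<le> (\<Sum>i<n. d (\<gamma> (t i)) (\<gamma> (t (Suc i))))"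
    using assms(1) unfolding partition_sum_ge_def by blast
  have "ennreal v \<le> (\<Sum>i<n. ennreal (d (\<gamma> (t i)) (\<gamma> (t (Suc i)))))"
    using t(4) assms(2) by (simp add: sum_ennreal ennreal_leI)
  also have "\<dots> \<le> curve_length d \<gamma> a b"
    unfolding curve_length_def using t by (intro SUP_upper2[of "(n, t)"]) auto
  finally show ?thesis .
qed

text \<open>Half-angle formula \<open>cosh t = 1 + 2 * (sinh (t / 2))\<^sup>2\<close> together with
  \<open>x \<le> sinh x\<close> for nonnegative \<open>x\<close>.\<close>

lemma cosh_ge_quadratic: "1 + t\<^sup>2 / 2 \<le> cosh (t::real)"
proof -
  have "(\<bar>t\<bar> / 2)\<^sup>2 \<le> (sinh (\<bar>t\<bar> / 2))\<^sup>2"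
    using real_le_x_sinh[of "\<bar>t\<bar> / 2"] by (intro power_mono) (auto simp: sinh_field_def exp_minus)
  moreover have "cosh (2 * (\<bar>t\<bar> / 2)) = 1 + 2 * (sinh (\<bar>t\<bar> / 2))\<^sup>2"
    using cosh_double[of "\<bar>t\<bar> / 2"] cosh_square_eq[of "\<bar>t\<bar> / 2"] by simp
  ultimately show ?thesis by (simp add: power_divide)
qed

section \<open>The metric of the half-space along slices and vertical lines\<close>

locale half_space_extension = N: metric_measure_space N dN \<mu>
  for N :: "'a set" and dN :: "'a \<Rightarrow> 'a \<Rightarrow> real" and \<mu> :: "'a measure" +
  fixes c :: real
  assumes doubling: "doubling N dN \<mu>" and c_pos: "0 < c"
begin

abbreviation "S \<equiv> half_space N"
abbreviation "d \<equiv> half_space_dist c dN"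
abbreviation "\<rho> \<equiv> half_space_measure \<mu>"
abbreviation "\<nu> \<equiv> density (restrict_space lborel {0<..}) (\<lambda>a::real. ennreal (1 / a))"

sublocale S: metric_measure_space S d \<rho>
  by (rule half_space_metric_measure_space)
    (use doubling c_pos N.metric_measure_space_axioms in auto)

lemma mem_half_space [simp]: "(x, a) \<in> S \<longleftrightarrow> x \<in> N \<and> 0 < a"
  by (simp add: half_space_def)

text \<open>Clearing the denominator in the argument of \<open>arcosh\<close> turns membership in a
  ball into a quadratic inequality in the base distance and the heights; the geometry of balls below
  works with this form.\<close>

lemma dist_less_iff:
  assumes "0 < a" "0 < b" "0 < R"
  shows "d (x, a) (y, b) < R \<longleftrightarrow> (dN x y)\<^sup>2 + a\<^sup>2 + b\<^sup>2 < 2 * a * b * cosh (R / c)"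
proof -
  define T where "T = 1 + ((dN x y)\<^sup>2 + (a - b)\<^sup>2) / (2 * a * b)"
  have "T \<ge> 1" using assms by (simp add: T_def)
  moreover have "T * (2 * a * b) = (dN x y)\<^sup>2 + a\<^sup>2 + b\<^sup>2"
    using assms by (simp add: T_def field_simps power2_eq_square)
  ultimately have T: "T \<ge> 1" "T * (2 * a * b) = (dN x y)\<^sup>2 + a\<^sup>2 + b\<^sup>2" by auto
  have "d (x, a) (y, b) < R \<longleftrightarrow> arcosh T < R / c"
    using assms c_pos by (simp add: half_space_dist_def T_def field_simps)
  also have "\<dots> \<longleftrightarrow> arcosh T < arcosh (cosh (R / c))"
    using assms c_pos by (simp add: arcosh_cosh_real)
  also have "\<dots> \<longleftrightarrow> T < cosh (R / c)"
    using T by (intro arcosh_less_iff_real) (auto simp: cosh_real_ge_1)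
  also have "\<dots> \<longleftrightarrow> T * (2 * a * b) < cosh (R / c) * (2 * a * b)"
    using assms by simp
  finally show ?thesis unfolding T(2) by (simp add: mult_ac)
qed

lemma mem_mball_iff:
  assumes "0 < R"
  shows "(x, a) \<in> S.mball (x0, a0) R \<longleftrightarrow> x0 \<in> N \<and> 0 < a0 \<and> x \<in> N \<and> 0 < a \<and>
    (dN x0 x)\<^sup>2 + a0\<^sup>2 + a\<^sup>2 < 2 * a0 * a * cosh (R / c)"
  using dist_less_iff[of a0 a R x0 x] assms by auto

lemma dist_horizontal_le:
  assumes "0 < a"
  shows "d (x, a) (y, a) \<le> c / a * dN x y"
proof -
  have "1 + (dN x y / a)\<^sup>2 / 2 \<le> cosh (dN x y / a)" by (rule cosh_ge_quadratic)
  then have "arcosh (1 + (dN x y / a)\<^sup>2 / 2) \<le> arcosh (cosh (dN x y / a))"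
    by (metis arcosh_less_iff_real cosh_real_ge_1 le_add_same_cancel1 not_le zero_le_divide_iff zero_le_numeral zero_le_power2)
  also have "\<dots> = dN x y / a" using assms by (simp add: arcosh_cosh_real)
  finally have "c * arcosh (1 + (dN x y / a)\<^sup>2 / 2) \<le> c * (dN x y / a)"
    using c_pos by (intro mult_left_mono) auto
  then show ?thesis
    using assms by (simp add: half_space_dist_def power_divide power2_eq_square mult_ac)
qed

text \<open>Only a local bound can hold, since horizontal distances grow logarithmically in
  \<open>dN\<close>. As \<open>cosh (z * t)\<close> is \<open>1 + z\<^sup>2 * t\<^sup>2 / 2\<close>
  up to higher order and \<open>z < 1\<close>, it stays below \<open>1 + t\<^sup>2 / 2\<close> for
  small \<open>t = dN x y / a\<close>, uniformly in the two points.\<close>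

lemma dist_horizontal_ge:
  assumes "0 < a" "0 < z" "z < 1"
  obtains \<eta> where "0 < \<eta>" "\<And>x y. dN x y < \<eta> \<Longrightarrow> z * (c / a * dN x y) \<le> d (x, a) (y, a)"
proof -
  have "((\<lambda>t. (cosh (z * t) - 1) / t\<^sup>2) \<longlongrightarrow> z\<^sup>2 / 2) (at_right 0)"
    unfolding power2_eq_square[of z] by real_asymp
  moreover have "z\<^sup>2 / 2 < 1 / 2" using assms by (simp add: power_less_one_iff)
  ultimately have "eventually (\<lambda>t. (cosh (z * t) - 1) / t\<^sup>2 < 1 / 2) (at_right 0)"
    by (rule order_tendstoD)
  then have "eventually (\<lambda>t. cosh (z * t) \<le> 1 + t\<^sup>2 / 2) (at_right 0)"
    using eventually_at_right_less[of 0] by eventually_elim (simp add: field_simps)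
  then obtain \<epsilon> where \<epsilon>: "\<epsilon> > 0" "\<And>t. 0 < t \<Longrightarrow> t < \<epsilon> \<Longrightarrow> cosh (z * t) \<le> 1 + t\<^sup>2 / 2"
    by (auto simp: eventually_at_right_field)
  show ?thesis
  proof (rule that[of "a * \<epsilon>"])
    fix x y assume xy: "dN x y < a * \<epsilon>"
    define t where "t = dN x y / a"
    have t: "0 \<le> t" "t < \<epsilon>" using xy assms by (auto simp: t_def field_simps)
    have "cosh (z * t) \<le> 1 + t\<^sup>2 / 2"
      using \<epsilon>(2)[of t] t by (cases "t = 0") auto
    then have "arcosh (cosh (z * t)) \<le> arcosh (1 + t\<^sup>2 / 2)"
      by (metis arcosh_less_iff_real cosh_real_ge_1 le_add_same_cancel1 not_le zero_le_divide_iff zero_le_numeral zero_le_power2)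
    then have "c * (z * t) \<le> c * arcosh (1 + t\<^sup>2 / 2)"
      using t assms c_pos by (simp add: arcosh_cosh_real)
    then show "z * (c / a * dN x y) \<le> d (x, a) (y, a)"
      using assms by (simp add: half_space_dist_def t_def power_divide power2_eq_square mult_ac)
  qed (use assms \<epsilon> in auto)
qed

text \<open>In the logarithmic height the argument of \<open>arcosh\<close> is exactly
  \<open>cosh (s - t)\<close>, so vertical lines are geodesics of speed \<open>c\<close>.\<close>

lemma dist_vertical:
  assumes "x \<in> N" "0 < a"
  shows "d (x, a * exp s) (x, a * exp t) = c * \<bar>s - t\<bar>"
proof -
  have "1 + (a * exp s - a * exp t)\<^sup>2 / (2 * (a * exp s) * (a * exp t)) = cosh (s - t)"
  proof -
    have "(a * exp s - a * exp t)\<^sup>2 / (2 * (a * exp s) * (a * exp t)) = (exp s - exp t)\<^sup>2 / (2 * exp s * exp t)"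
      using assms by (simp add: field_simps power2_eq_square)
    then show ?thesis
      by (simp add: cosh_field_def exp_diff field_simps power2_eq_square)
  qed
  then have "1 + ((dN x x)\<^sup>2 + (a * exp s - a * exp t)\<^sup>2) / (2 * (a * exp s) * (a * exp t)) = cosh \<bar>s - t\<bar>"
    using assms by simp
  then have "d (x, a * exp s) (x, a * exp t) = c * arcosh (cosh \<bar>s - t\<bar>)"
    unfolding half_space_dist_def using assms by (simp only: prod.case) simp
  then show ?thesis by (simp only: arcosh_cosh_real abs_ge_zero)
qed

section \<open>Curves lifted to horizontal slices\<close>

text \<open>Chords of the lifted curve can be much shorter than \<open>c / a\<close> times those of
  \<gamma>. For the lower bound a partition is therefore refined until its steps are below the
  \<eta> of \<open>dist_horizontal_ge\<close>, and the lost factor \<open>z\<close> then tends to 1.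
  Equality is needed because the arclength parametrizations are compared through the length
  functions.\<close>

lemma curve_length_horizontal:
  assumes \<gamma>: "curve_in N dN L \<gamma>" and t: "0 \<le> t" "t \<le> L" and a: "0 < a"
  shows "curve_length d (\<lambda>s. (\<gamma> s, a)) 0 t = ennreal (c / a) * curve_length dN \<gamma> 0 t"
proof (rule antisym)
  have cont: "continuous_map (top_of_set {0..L}) N.mtopology \<gamma>" using \<gamma> by (simp add: curve_in_def)
  have \<gamma>N: "\<gamma> s \<in> N" if "0 \<le> s" "s \<le> L" for s
    using continuous_map_image_subset_topspace[OF cont] that by auto
  let ?\<Gamma> = "\<lambda>s. (\<gamma> s, a)"
  show "curve_length d ?\<Gamma> 0 t \<le> ennreal (c / a) * curve_length dN \<gamma> 0 t"
    unfolding curve_length_def[of d]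
  proof (safe intro!: SUP_least)
    fix n and \<tau> :: "nat \<Rightarrow> real" assume \<tau>: "\<tau> 0 = 0" "t = \<tau> n" "mono_on {..n} \<tau>"
    have "(\<Sum>i<n. ennreal (d (?\<Gamma> (\<tau> i)) (?\<Gamma> (\<tau> (Suc i)))))
        \<le> (\<Sum>i<n. ennreal (c / a) * ennreal (dN (\<gamma> (\<tau> i)) (\<gamma> (\<tau> (Suc i)))))"
      using a c_pos dist_horizontal_le[OF a]
      by (intro sum_mono) (simp flip: ennreal_mult add: ennreal_leI)
    also have "\<dots> = ennreal (c / a) * (\<Sum>i<n. ennreal (dN (\<gamma> (\<tau> i)) (\<gamma> (\<tau> (Suc i)))))"
      by (simp only: sum_distrib_left)
    also have "\<dots> \<le> ennreal (c / a) * curve_length dN \<gamma> 0 (\<tau> n)"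
      unfolding curve_length_def using \<tau>
      by (intro mult_left_mono SUP_upper2[of "(n, \<tau>)"]) auto
    finally show "(\<Sum>i<n. ennreal (d (?\<Gamma> (\<tau> i)) (?\<Gamma> (\<tau> (Suc i))))) \<le> ennreal (c / a) * curve_length dN \<gamma> 0 (\<tau> n)" .
  qed
  have step: "partition_sum_ge d ?\<Gamma> s u (z * (c / a * dN (\<gamma> s) (\<gamma> u)))"
    if z: "0 < z" "z < 1" and su: "0 \<le> s" "s \<le> u" "u \<le> t" for z s u
  proof -
    obtain \<eta> where \<eta>: "0 < \<eta>" "\<And>x y. dN x y < \<eta> \<Longrightarrow> z * (c / a * dN x y) \<le> d (x, a) (y, a)"
      using dist_horizontal_ge[OF a z] by blast
    \<comment> \<open>The bound passes to the union of adjacent intervals by the triangle inequality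
      of \<open>dN\<close>, and it holds on short intervals by continuity. The premise inside
      \<open>P\<close> is there because the short intervals in \<open>Bolzano\<close> may leave
      \<open>[s, u]\<close>.\<close>
    define P where "P s u \<longleftrightarrow> (0 \<le> s \<and> u \<le> t \<longrightarrow> partition_sum_ge d ?\<Gamma> s u (z * (c / a * dN (\<gamma> s) (\<gamma> u))))" for s u
    from su(2) have "P s u"
    proof (induction rule: Bolzano)
      case (trans s u v)
      show ?case unfolding P_def
      proof
        assume *: "0 \<le> s \<and> v \<le> t"
        then have "partition_sum_ge d ?\<Gamma> s v (z * (c / a * dN (\<gamma> s) (\<gamma> u)) + z * (c / a * dN (\<gamma> u) (\<gamma> v)))"
          using trans by (intro partition_sum_ge_trans) (auto simp: P_def)
        moreover have "z * (c / a * dN (\<gamma> s) (\<gamma> v)) \<le> z * (c / a * (dN (\<gamma> s) (\<gamma> u) + dN (\<gamma> u) (\<gamma> v)))"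
          using * t trans a c_pos z by (intro mult_left_mono N.triangle \<gamma>N) auto
        ultimately show "partition_sum_ge d ?\<Gamma> s v (z * (c / a * dN (\<gamma> s) (\<gamma> v)))"
          by (auto simp: distrib_left intro: partition_sum_ge_mono)
      qed
    next
      case (local x)
      have x: "x \<in> {0..L}" using local su t by auto
      then obtain U where U: "openin (top_of_set {0..L}) U" "x \<in> U" "\<And>y. y \<in> U \<Longrightarrow> \<gamma> y \<in> N.mball (\<gamma> x) (\<eta> / 2)"
        using cont \<eta>(1) unfolding N.continuous_map_to_metric
        by (metis half_gt_zero topspace_euclidean_subtopology)
      then obtain \<delta> where \<delta>: "\<delta> > 0" "\<And>y. y \<in> {0..L} \<Longrightarrow> dist y x < \<delta> \<Longrightarrow> y \<in> U"
        unfolding openin_euclidean_subtopology_iff by blast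
      have near: "dN (\<gamma> x) (\<gamma> y) < \<eta> / 2" if "y \<in> {0..L}" "dist y x < \<delta>" for y
        using U(3) \<delta>(2) that by auto
      have "P v w" if "v \<le> x" "x \<le> w" "w - v < \<delta>" for v w
        unfolding P_def
      proof
        assume *: "0 \<le> v \<and> w \<le> t"
        have "dN (\<gamma> v) (\<gamma> w) \<le> dN (\<gamma> x) (\<gamma> v) + dN (\<gamma> x) (\<gamma> w)"
          using N.triangle[of "\<gamma> v" "\<gamma> x" "\<gamma> w"] \<gamma>N * that t x by (auto simp: N.commute)
        also have "\<dots> < \<eta>"
          using near[of v] near[of w] that * t by (auto simp: dist_real_def)
        finally have "z * (c / a * dN (\<gamma> v) (\<gamma> w)) \<le> d (?\<Gamma> v) (?\<Gamma> w)" by (rule \<eta>(2))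
        then show "partition_sum_ge d ?\<Gamma> v w (z * (c / a * dN (\<gamma> v) (\<gamma> w)))"
          using that by (intro partition_sum_ge_mono[OF partition_sum_ge_dist]) auto
      qed
      then show ?case using \<delta>(1) by blast
    qed
    then show ?thesis using su by (simp add: P_def)
  qed
  show "ennreal (c / a) * curve_length dN \<gamma> 0 t \<le> curve_length d ?\<Gamma> 0 t"
    unfolding curve_length_def[of dN] SUP_mult_left_ennreal
  proof (safe intro!: SUP_least)
    fix n and \<tau> :: "nat \<Rightarrow> real" assume \<tau>: "\<tau> 0 = 0" "t = \<tau> n" "mono_on {..n} \<tau>"
    have bounds: "0 \<le> \<tau> i" "\<tau> i \<le> t" if "i \<le> n" for i
      using mono_onD[OF \<tau>(3), of 0 i] mono_onD[OF \<tau>(3), of i n] \<tau> that by auto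
    define K where "K = c / a * (\<Sum>i<n. dN (\<gamma> (\<tau> i)) (\<gamma> (\<tau> (Suc i))))"
    have K: "K \<ge> 0" using a c_pos unfolding K_def
      by (intro mult_nonneg_nonneg sum_nonneg divide_nonneg_nonneg) auto
    have le: "ennreal (z * K) \<le> curve_length d ?\<Gamma> 0 (\<tau> n)" if z: "0 < z" "z < 1" for z
    proof -
      have "partition_sum_ge d ?\<Gamma> (\<tau> 0) (\<tau> m) (\<Sum>i<m. z * (c / a * dN (\<gamma> (\<tau> i)) (\<gamma> (\<tau> (Suc i)))))"
        if "m \<le> n" for m using that
      proof (induction m)
        case (Suc m)
        then have "\<tau> m \<le> \<tau> (Suc m)" using \<tau>(3) by (simp add: mono_onD)
        then have "partition_sum_ge d ?\<Gamma> (\<tau> m) (\<tau> (Suc m)) (z * (c / a * dN (\<gamma> (\<tau> m)) (\<gamma> (\<tau> (Suc m)))))"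
          using bounds Suc.prems step[OF z, of "\<tau> m" "\<tau> (Suc m)"] by simp
        then show ?case
          unfolding sum.lessThan_Suc using Suc.prems
          by (intro partition_sum_ge_trans[OF Suc.IH]) simp_all
      qed (simp add: partition_sum_ge_refl)
      from this[of n] have "partition_sum_ge d ?\<Gamma> 0 (\<tau> n) (z * K)"
        by (simp add: K_def sum_distrib_left \<tau>)
      then show ?thesis by (rule partition_sum_ge_curve_length) simp
    qed
    have "ennreal K \<le> curve_length d ?\<Gamma> 0 (\<tau> n)"
    proof (cases "curve_length d ?\<Gamma> 0 (\<tau> n)")
      case (real r)
      have "z * K \<le> r" if "0 < z" "z < 1" for z
        using le[OF that] real by simp
      then have "K \<le> r" by (rule field_le_mult_one_interval)
      then show ?thesis using real by (simp add: ennreal_leI)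
    qed simp
    then show "ennreal (c / a) * (\<Sum>i<n. ennreal (dN (\<gamma> (\<tau> i)) (\<gamma> (\<tau> (Suc i))))) \<le> curve_length d ?\<Gamma> 0 (\<tau> n)"
      using a c_pos by (simp add: K_def ennreal_mult sum_nonneg del: times_divide_eq_left)
  qed
qed

lemma curve_in_horizontal:
  assumes \<gamma>: "curve_in N dN L \<gamma>" and a: "0 < a"
  shows "curve_in S d L (\<lambda>s. (\<gamma> s, a))"
proof -
  have cont: "continuous_map (top_of_set {0..L}) N.mtopology \<gamma>" using \<gamma> by (simp add: curve_in_def)
  have "continuous_map (top_of_set {0..L}) S.mtopology (\<lambda>s. (\<gamma> s, a))"
    unfolding S.continuous_map_to_metric
  proof (intro ballI allI impI)
    fix x \<epsilon> assume x: "x \<in> topspace (top_of_set {0..L})" and \<epsilon>: "\<epsilon> > (0::real)"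
    have "\<epsilon> * a / c > 0" using \<epsilon> a c_pos by simp
    then obtain U where U: "openin (top_of_set {0..L}) U" "x \<in> U" "\<And>y. y \<in> U \<Longrightarrow> \<gamma> y \<in> N.mball (\<gamma> x) (\<epsilon> * a / c)"
      using cont x unfolding N.continuous_map_to_metric by metis
    have "(\<gamma> y, a) \<in> S.mball (\<gamma> x, a) \<epsilon>" if "y \<in> U" for y
    proof -
      have "c / a * dN (\<gamma> x) (\<gamma> y) < \<epsilon>"
        using U(3)[OF that] a c_pos by (simp add: field_simps)
      then have "d (\<gamma> x, a) (\<gamma> y, a) < \<epsilon>"
        using dist_horizontal_le[OF a] by (rule order.strict_trans1[rotated])
      then show ?thesis using U(3)[OF that] a by simp
    qed
    then show "\<exists>U. openin (top_of_set {0..L}) U \<and> x \<in> U \<and> (\<forall>y\<in>U. (\<gamma> y, a) \<in> S.mball (\<gamma> x, a) \<epsilon>)"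
      using U by blast
  qed
  then show ?thesis using \<gamma> by (simp add: curve_in_def)
qed

text \<open>
  As the two length functions are proportional, the choices made by both arclength
  parametrizations range over the same sets of parameters and therefore agree.
\<close>

lemma line_integral_horizontal_le:
  assumes \<gamma>: "rectifiable_curve N dN L \<gamma>" and a: "0 < a"
  shows "line_integral d L (\<lambda>s. (\<gamma> s, a)) g \<le> line_integral dN L \<gamma> (\<lambda>x. ennreal (c / a) * g (x, a))"
proof -
  define k where "k = c / a"
  have k: "k > 0" using a c_pos by (simp add: k_def)
  have len: "curve_length d (\<lambda>s. (\<gamma> s, a)) 0 t = ennreal k * curve_length dN \<gamma> 0 t" if "t \<in> {0..L}" for t
    using curve_length_horizontal[of L \<gamma> t a] \<gamma> a that by (simp add: rectifiable_curve_def k_def)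
  have L: "L \<ge> 0" using \<gamma> by (simp add: rectifiable_curve_def curve_in_def)
  obtain l where l: "curve_length dN \<gamma> 0 L = ennreal l" "0 \<le> l"
    using \<gamma> by (cases "curve_length dN \<gamma> 0 L") (auto simp: rectifiable_curve_def)
  have lenS: "curve_length d (\<lambda>s. (\<gamma> s, a)) 0 L = ennreal (k * l)"
    using len[of L] L l k by (simp add: ennreal_mult)
  have param: "arclength_param d L (\<lambda>s. (\<gamma> s, a)) (k * s) = (arclength_param dN L \<gamma> s, a)" if "0 \<le> s" for s
  proof -
    have "ennreal k * X = ennreal (k * s) \<longleftrightarrow> X = ennreal s" for X
      using k that by (cases X) (auto simp: ennreal_mult_top simp flip: ennreal_mult)
    then have "(t \<in> {0..L} \<and> curve_length d (\<lambda>s. (\<gamma> s, a)) 0 t = ennreal (k * s))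
        \<longleftrightarrow> (t \<in> {0..L} \<and> curve_length dN \<gamma> 0 t = ennreal s)" for t
      using len by (auto simp del: atLeastAtMost_iff)
    then show ?thesis by (simp add: arclength_param_def)
  qed
  have "line_integral d L (\<lambda>s. (\<gamma> s, a)) g
      = (\<integral>\<^sup>+s\<in>{0..k * l}. g (arclength_param d L (\<lambda>s. (\<gamma> s, a)) s) \<partial>lborel)"
    using k l by (simp add: line_integral_def lenS)
  also have "\<dots> \<le> (\<integral>\<^sup>+s. ennreal k * (g (arclength_param d L (\<lambda>s. (\<gamma> s, a)) (k * s)) * indicator {0..k * l} (k * s)) \<partial>lborel)"
    by (rule nn_integral_lborel_scale_le) fact
  also have "\<dots> = (\<integral>\<^sup>+s\<in>{0..l}. ennreal k * g (arclength_param dN L \<gamma> s, a) \<partial>lborel)"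
  proof (intro nn_integral_cong)
    fix s
    have "indicator {0..k * l} (k * s) = (indicator {0..l} s :: ennreal)"
      using k by (auto simp: indicator_def zero_le_mult_iff)
    then show "ennreal k * (g (arclength_param d L (\<lambda>s. (\<gamma> s, a)) (k * s)) * indicator {0..k * l} (k * s))
      = ennreal k * g (arclength_param dN L \<gamma> s, a) * indicator {0..l} s"
      using param[of s] by (cases "s \<in> {0..l}") (auto simp: mult_ac)
  qed
  finally show ?thesis using l by (simp add: line_integral_def k_def)
qed

section \<open>Measurability and finiteness for the product measure\<close>

lemma sets_mball [measurable]: "N.mball x r \<in> sets \<mu>" "S.mball q R \<in> sets \<rho>"
proof -
  have "{U. openin N.mtopology U} \<subseteq> Pow N" "{U. openin S.mtopology U} \<subseteq> Pow S"
    using N.openin_mtopology S.openin_mtopology by auto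
  then show "N.mball x r \<in> sets \<mu>" "S.mball q R \<in> sets \<rho>"
    using N.openin_mball S.openin_mball by (auto simp: N.sets_mu S.sets_mu)
qed

lemma emeasure_mball_finite: "emeasure \<mu> (N.mball x r) < \<infinity>"
proof (cases "x \<in> N \<and> 0 < r")
  case True
  then show ?thesis using doubling unfolding doubling_def by blast
next
  case False
  then have "N.mball x r = {}" by (auto simp: N.mball_eq_empty)
  then show ?thesis by simp
qed

lemma rho_eq: "\<rho> = \<mu> \<Otimes>\<^sub>M \<nu>"
  by (simp add: half_space_measure_def)

lemma space_nu [simp]: "space \<nu> = {0<..}"
  by (simp add: space_restrict_space)

lemma sigma_finite_mu: "sigma_finite_measure \<mu>"
proof
  show "\<exists>A. countable A \<and> A \<subseteq> sets \<mu> \<and> \<Union>A = space \<mu> \<and> (\<forall>a\<in>A. emeasure \<mu> a \<noteq> \<infinity>)"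
  proof (cases "N = {}")
    case True
    then show ?thesis by (intro exI[of _ "{}"]) (simp add: N.space_mu)
  next
    case False
    then obtain x0 where x0: "x0 \<in> N" by blast
    show ?thesis
    proof (intro exI[of _ "range (\<lambda>n::nat. N.mball x0 (real n))"] conjI)
      show "\<Union> (range (\<lambda>n::nat. N.mball x0 (real n))) = space \<mu>"
        using x0 reals_Archimedean2 by (fastforce simp: N.space_mu)
      show "\<forall>a\<in>range (\<lambda>n::nat. N.mball x0 (real n)). emeasure \<mu> a \<noteq> \<infinity>"
        using emeasure_mball_finite[of x0] by (auto simp: less_top)
    qed auto
  qed
qed

lemma sigma_finite_nu: "sigma_finite_measure \<nu>"
proof -
  interpret R: sigma_finite_measure "restrict_space lborel {0::real<..}"
    by (rule sigma_finite_measure_restrict_space) (auto intro: lborel.sigma_finite_measure_axioms)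
  have "(\<lambda>a::real. ennreal (1 / a)) \<in> borel_measurable (restrict_space lborel {0<..})"
    by (intro measurable_restrict_space1) simp
  then show ?thesis by (subst R.sigma_finite_iff_density_finite) auto
qed

sublocale P: pair_sigma_finite \<mu> \<nu>
  by (intro pair_sigma_finite.intro sigma_finite_mu sigma_finite_nu)

text \<open>Upper gradients are Borel for the metric \<open>d\<close>, whereas Fubini's theorem asks
  for measurability with respect to the product; this identifies the two.\<close>

lemma measurable_borel_alg_S: "borel_measurable (borel_alg S d) = borel_measurable \<rho>"
  by (intro measurable_cong_sets) (simp_all add: S.sets_mu)

lemma measurable_borel_alg_N: "borel_measurable (borel_alg N dN) = borel_measurable \<mu>"
  by (intro measurable_cong_sets) (simp_all add: N.sets_mu)

lemma measurable_horizontal: "h \<in> borel_measurable \<rho> \<Longrightarrow> 0 < a \<Longrightarrow> (\<lambda>x. h (x, a)) \<in> borel_measurable \<mu>"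
  using measurable_compose[OF measurable_Pair2'[of a \<nu> \<mu>], of h borel] by (simp add: rho_eq)

lemma measurable_vertical: "h \<in> borel_measurable \<rho> \<Longrightarrow> x \<in> N \<Longrightarrow> (\<lambda>a. h (x, a)) \<in> borel_measurable \<nu>"
  using measurable_compose[OF measurable_Pair1'[of x \<mu> \<nu>], of h borel] by (simp add: rho_eq N.space_mu)

section \<open>Upper gradients along slices and vertical segments\<close>

text \<open>The factor \<open>c / a\<close> is the ratio between the lengths of a lifted curve and
  of the curve itself.\<close>

lemma upper_gradient_horizontal:
  assumes g: "upper_gradient S d f g" and a: "0 < a"
  shows "upper_gradient N dN (\<lambda>x. f (x, a)) (\<lambda>x. ennreal (c / a) * g (x, a))"
proof -
  have [measurable]: "(\<lambda>x. g (x, a)) \<in> borel_measurable \<mu>"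
    using g a by (intro measurable_horizontal) (simp_all add: upper_gradient_def measurable_borel_alg_S)
  have "(\<lambda>x. ennreal (c / a) * g (x, a)) \<in> borel_measurable (borel_alg N dN)"
    unfolding measurable_borel_alg_N by measurable
  moreover have "ennreal \<bar>f (\<gamma> 0, a) - f (\<gamma> L, a)\<bar> \<le> line_integral dN L \<gamma> (\<lambda>x. ennreal (c / a) * g (x, a))"
    if \<gamma>: "rectifiable_curve N dN L \<gamma>" for L \<gamma>
  proof -
    have c: "curve_in N dN L \<gamma>" using \<gamma> by (simp add: rectifiable_curve_def)
    have "0 \<le> L" using c by (simp add: curve_in_def)
    then have "rectifiable_curve S d L (\<lambda>s. (\<gamma> s, a))"
      using curve_in_horizontal[OF c a] curve_length_horizontal[OF c _ order_refl a] \<gamma>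
      by (auto simp: rectifiable_curve_def ennreal_mult_less_top)
    then have "ennreal \<bar>f (\<gamma> 0, a) - f (\<gamma> L, a)\<bar> \<le> line_integral d L (\<lambda>s. (\<gamma> s, a)) g"
      using g unfolding upper_gradient_def by blast
    then show ?thesis using line_integral_horizontal_le[OF \<gamma> a] by (rule order_trans)
  qed
  ultimately show ?thesis by (simp add: upper_gradient_def)
qed

text \<open>Under the substitution \<open>a = a1 * exp t\<close> the measure \<open>da / a\<close>
  becomes Lebesgue measure in the logarithmic height.\<close>

lemma nn_integral_nu_interval:
  assumes h: "h \<in> borel_measurable \<nu>" and a: "0 < a1" "a1 < a2"
  shows "(\<integral>\<^sup>+a\<in>{a1..a2}. h a \<partial>\<nu>) = (\<integral>\<^sup>+t\<in>{0..ln (a2 / a1)}. h (a1 * exp t) \<partial>lborel)"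
proof -
  \<comment> \<open>Extension by zero, with the density absorbed, provides a Borel function on the
    whole line for the substitution rule.\<close>
  define F where "F a = h a * ennreal (1 / a) * indicator {0<..} a" for a
  have h': "h \<in> borel_measurable (restrict_space lborel {0<..})" using h by simp
  have inv: "(\<lambda>a. ennreal (1 / a)) \<in> borel_measurable (restrict_space lborel {0::real<..})"
    by (intro measurable_restrict_space1) simp
  have ind: "(indicator {a1..a2} :: real \<Rightarrow> ennreal) \<in> borel_measurable (restrict_space lborel {0<..})"
    by (intro measurable_restrict_space1) simp
  have "(\<lambda>a. h a * ennreal (1 / a)) \<in> borel_measurable (restrict_space borel {0<..})"
    using h' inv borel_measurable_times_ennreal[of h "restrict_space lborel {0<..}" "\<lambda>a. ennreal (1 / a)"]
    by (simp cong: measurable_cong_sets add: sets_restrict_space)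
  then have F[measurable]: "F \<in> borel_measurable borel"
    unfolding F_def by (subst (asm) borel_measurable_restrict_space_iff_ennreal) auto
  define T where "T = ln (a2 / a1)"
  have T: "T > 0" "a1 * exp T = a2" using a by (auto simp: T_def)
  have "(\<integral>\<^sup>+a\<in>{a1..a2}. h a \<partial>\<nu>)
      = (\<integral>\<^sup>+a. ennreal (1 / a) * (h a * indicator {a1..a2} a) \<partial>restrict_space lborel {0<..})"
    using h' inv ind by (intro nn_integral_density borel_measurable_times_ennreal)
  also have "\<dots> = (\<integral>\<^sup>+a. ennreal (1 / a) * (h a * indicator {a1..a2} a) * indicator {0<..} a \<partial>lborel)"
    by (rule nn_integral_restrict_space) simp
  also have "\<dots> = (\<integral>\<^sup>+a. F a * indicator {a1 * exp 0..a1 * exp T} a \<partial>lborel)"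
    by (intro nn_integral_cong) (simp add: F_def mult_ac T)
  also have "\<dots> = (\<integral>\<^sup>+t. F (a1 * exp t) * ennreal (a1 * exp t) * indicator {0..T} t \<partial>lborel)"
    using a T by (intro nn_integral_substitution_aux) (auto intro!: derivative_eq_intros continuous_intros)
  also have "\<dots> = (\<integral>\<^sup>+t\<in>{0..T}. h (a1 * exp t) \<partial>lborel)"
  proof (intro nn_integral_cong)
    fix t :: real
    have "ennreal (1 / (a1 * exp t)) * ennreal (a1 * exp t) = 1"
      using a by (simp flip: ennreal_mult)
    then show "F (a1 * exp t) * ennreal (a1 * exp t) * indicator {0..T} t = h (a1 * exp t) * indicator {0..T} t"
      using a by (simp add: F_def mult.assoc)
  qed
  finally show ?thesis by (simp add: T_def)
qed

lemma emeasure_nu_interval: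
  assumes "0 < a1" "a1 < a2"
  shows "emeasure \<nu> {a1..a2} = ennreal (ln (a2 / a1))"
proof -
  have "{a1..a2} \<in> sets \<nu>" using assms by (simp add: sets_restrict_space_iff subset_iff)
  then show ?thesis
    using nn_integral_nu_interval[of "\<lambda>_. 1", OF _ assms] assms by simp
qed

text \<open>The vertical segment has unit speed when its height is \<open>a1 * exp (s / c)\<close>;
  passing from arclength to \<nu> then costs the factor \<open>c\<close>.\<close>

lemma upper_gradient_vertical:
  assumes g: "upper_gradient S d f g" and x: "x \<in> N" and a: "0 < a1" "a1 < a2"
  shows "ennreal \<bar>f (x, a1) - f (x, a2)\<bar> \<le> ennreal c * (\<integral>\<^sup>+a\<in>{a1..a2}. g (x, a) \<partial>\<nu>)"
proof -
  have gm: "g \<in> borel_measurable \<rho>" using g by (simp add: upper_gradient_def measurable_borel_alg_S)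
  define T where "T = ln (a2 / a1)"
  have T: "T > 0" "a1 * exp T = a2" using a by (auto simp: T_def)
  define \<Gamma> where "\<Gamma> s = (x, a1 * exp (s / c))" for s
  have dist: "d (\<Gamma> s) (\<Gamma> t) = \<bar>s - t\<bar>" for s t
    using dist_vertical[OF x a(1), of "s / c" "t / c"] c_pos
    by (simp add: \<Gamma>_def flip: diff_divide_distrib)
  have \<Gamma>S: "\<Gamma> s \<in> S" for s using x a by (simp add: \<Gamma>_def)
  have "continuous_map (top_of_set {0..c * T}) S.mtopology \<Gamma>"
    unfolding S.continuous_map_to_metric
  proof (intro ballI allI impI)
    fix s \<epsilon> assume s: "s \<in> topspace (top_of_set {0..c * T})" and \<epsilon>: "\<epsilon> > (0::real)"
    show "\<exists>U. openin (top_of_set {0..c * T}) U \<and> s \<in> U \<and> (\<forall>y\<in>U. \<Gamma> y \<in> S.mball (\<Gamma> s) \<epsilon>)"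
      using s \<epsilon> \<Gamma>S dist
      by (intro exI[of _ "{0..c * T} \<inter> ball s \<epsilon>"]) (auto simp: dist_real_def openin_open_Int)
  qed
  then have curve: "curve_in S d (c * T) \<Gamma>" using c_pos T by (simp add: curve_in_def)
  have len: "curve_length d \<Gamma> 0 t = ennreal t" if "0 \<le> t" for t
  proof (rule antisym)
    show "curve_length d \<Gamma> 0 t \<le> ennreal t"
      unfolding curve_length_def
    proof (safe intro!: SUP_least)
      fix n and \<tau> :: "nat \<Rightarrow> real" assume \<tau>: "\<tau> 0 = 0" "t = \<tau> n" "mono_on {..n} \<tau>"
      have "(\<Sum>i<n. d (\<Gamma> (\<tau> i)) (\<Gamma> (\<tau> (Suc i)))) = (\<Sum>i<n. \<tau> (Suc i) - \<tau> i)"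
        using \<tau>(3) by (intro sum.cong) (auto simp: dist mono_onD)
      also have "\<dots> = \<tau> n" using \<tau>(1) by (simp add: sum_lessThan_telescope)
      finally show "(\<Sum>i<n. ennreal (d (\<Gamma> (\<tau> i)) (\<Gamma> (\<tau> (Suc i))))) \<le> ennreal (\<tau> n)"
        by (simp add: sum_ennreal)
    qed
    show "ennreal t \<le> curve_length d \<Gamma> 0 t"
      using partition_sum_ge_curve_length[OF partition_sum_ge_dist[OF that, of d \<Gamma>]] dist that by simp
  qed
  have "rectifiable_curve S d (c * T) \<Gamma>"
    using curve len c_pos T by (simp add: rectifiable_curve_def)
  then have "ennreal \<bar>f (\<Gamma> 0) - f (\<Gamma> (c * T))\<bar> \<le> line_integral d (c * T) \<Gamma> g"
    using g unfolding upper_gradient_def by blast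
  then have "ennreal \<bar>f (x, a1) - f (x, a2)\<bar> \<le> line_integral d (c * T) \<Gamma> g"
    using c_pos T by (simp add: \<Gamma>_def)
  also have "\<dots> = (\<integral>\<^sup>+s\<in>{0..c * T}. g (\<Gamma> s) \<partial>lborel)"
  proof -
    \<comment> \<open>The length function is the identity, so the choice has a single
      candidate.\<close>
    have "arclength_param d (c * T) \<Gamma> s = \<Gamma> s" if "s \<in> {0..c * T}" for s
    proof -
      have "t \<in> {0..c * T} \<and> curve_length d \<Gamma> 0 t = ennreal s \<longleftrightarrow> t = s" for t
        using that len[of t] by auto
      then show ?thesis by (simp add: arclength_param_def)
    qed
    then show ?thesis
      using c_pos T len[of "c * T"] unfolding line_integral_def
      by (intro nn_integral_cong) (auto simp: indicator_def)
  qed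
  also have "\<dots> \<le> (\<integral>\<^sup>+s. ennreal c * (g (\<Gamma> (c * s)) * indicator {0..c * T} (c * s)) \<partial>lborel)"
    using c_pos by (rule nn_integral_lborel_scale_le)
  also have "\<dots> = (\<integral>\<^sup>+s. ennreal c * (g (x, a1 * exp s) * indicator {0..T} s) \<partial>lborel)"
    using c_pos by (intro nn_integral_cong) (auto simp: \<Gamma>_def indicator_def zero_le_mult_iff)
  also have "\<dots> = ennreal c * (\<integral>\<^sup>+s\<in>{0..T}. g (x, a1 * exp s) \<partial>lborel)"
  proof (rule nn_integral_cmult)
    have "(\<lambda>s. (x, a1 * exp s)) \<in> lborel \<rightarrow>\<^sub>M \<mu> \<Otimes>\<^sub>M \<nu>"
      using x a by (intro measurable_Pair) (auto simp: N.space_mu intro!: measurable_restrict_space2)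
    then have "(\<lambda>s. g (x, a1 * exp s)) \<in> borel_measurable lborel"
      using gm unfolding rho_eq by (rule measurable_compose)
    then show "(\<lambda>s. g (x, a1 * exp s) * indicator {0..T} s) \<in> borel_measurable lborel"
      by measurable
  qed
  also have "(\<integral>\<^sup>+s\<in>{0..T}. g (x, a1 * exp s) \<partial>lborel) = (\<integral>\<^sup>+a\<in>{a1..a2}. g (x, a) \<partial>\<nu>)"
    unfolding T_def using nn_integral_nu_interval[OF measurable_vertical[OF gm x] a] by simp
  finally show ?thesis .
qed

section \<open>Balls of the half-space\<close>

text \<open>As in the hyperbolic plane, completing the square exhibits the ball as a Euclidean disc
  in the coordinates \<open>dN x0 x\<close> and \<open>a\<close>, with centre at height
  \<open>a0 * cosh k\<close> and radius \<open>a0 * sinh k\<close>.\<close>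

lemma mball_subset_cylinder:
  assumes R: "0 < R" and z: "(x, a) \<in> S.mball (x0, a0) R"
  shows "dN x0 x < a0 * sinh (R / c)" "a0 * exp (- (R / c)) < a" "a < a0 * exp (R / c)"
proof -
  define k where "k = R / c"
  have k: "k > 0" using R c_pos by (simp add: k_def)
  have a0: "0 < a0" and less: "(dN x0 x)\<^sup>2 + a0\<^sup>2 + a\<^sup>2 < 2 * a0 * a * cosh k"
    using z unfolding mem_mball_iff[OF R] k_def by auto
  have "(a - a0 * cosh k)\<^sup>2 + (dN x0 x)\<^sup>2 = (dN x0 x)\<^sup>2 + a0\<^sup>2 + a\<^sup>2 - 2 * a0 * a * cosh k + a0\<^sup>2 * ((cosh k)\<^sup>2 - 1)"
    by (simp add: power2_eq_square algebra_simps)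
  also have "\<dots> < (a0 * sinh k)\<^sup>2"
    using less by (simp add: sinh_square_eq power_mult_distrib)
  finally have sq: "(a - a0 * cosh k)\<^sup>2 + (dN x0 x)\<^sup>2 < (a0 * sinh k)\<^sup>2" .
  have s: "0 < a0 * sinh k" using a0 k by simp
  have "(dN x0 x)\<^sup>2 < (a0 * sinh k)\<^sup>2" using sq zero_le_power2[of "a - a0 * cosh k"] by linarith
  then show "dN x0 x < a0 * sinh (R / c)"
    using s power_less_imp_less_base[of "dN x0 x" 2 "a0 * sinh k"] unfolding k_def by simp
  have "\<bar>a - a0 * cosh k\<bar>\<^sup>2 < (a0 * sinh k)\<^sup>2" using sq zero_le_power2[of "dN x0 x"] unfolding power2_abs by linarith
  then have "\<bar>a - a0 * cosh k\<bar> < a0 * sinh k" 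
    using s power_less_imp_less_base[of "\<bar>a - a0 * cosh k\<bar>" 2 "a0 * sinh k"] by simp
  moreover have "a0 * cosh k + a0 * sinh k = a0 * exp k" "a0 * cosh k - a0 * sinh k = a0 * exp (- k)"
    by (simp_all add: cosh_plus_sinh cosh_minus_sinh flip: distrib_left right_diff_distrib)
  ultimately show "a0 * exp (- (R / c)) < a" "a < a0 * exp (R / c)"
    unfolding k_def by linarith+
qed

text \<open>Over a fixed \<open>x\<close>, membership says that the convex quadratic
  \<open>w\<^sup>2 - m * w\<close> is below a constant, and on an interval it is largest at an end
  point.\<close>

lemma mball_vertically_convex:
  assumes R: "0 < R" and "(x, a) \<in> S.mball q R" "(x, b) \<in> S.mball q R" "a \<le> w" "w \<le> b"
  shows "(x, w) \<in> S.mball q R"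
proof -
  obtain x0 a0 where q: "q = (x0, a0)" by (cases q)
  define m where "m = 2 * a0 * cosh (R / c)"
  have *: "x0 \<in> N" "0 < a0" "x \<in> N" "0 < a" "(dN x0 x)\<^sup>2 + a0\<^sup>2 + a\<^sup>2 < m * a" "(dN x0 x)\<^sup>2 + a0\<^sup>2 + b\<^sup>2 < m * b"
    using assms(2,3) unfolding q mem_mball_iff[OF R] by (auto simp: m_def mult_ac)
  have "w\<^sup>2 - m * w \<le> max (a\<^sup>2 - m * a) (b\<^sup>2 - m * b)"
  proof (cases "w + a \<le> m")
    case True
    then have "(w - a) * (w + a - m) \<le> 0" using assms by (intro mult_nonneg_nonpos) auto
    then show ?thesis by (simp add: power2_eq_square algebra_simps)
  next
    case False
    then have "(b - w) * (b + w - m) \<ge> 0" using assms by (intro mult_nonneg_nonneg) auto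
    then show ?thesis by (simp add: power2_eq_square algebra_simps)
  qed
  then have "(dN x0 x)\<^sup>2 + a0\<^sup>2 + w\<^sup>2 < m * w" using * by linarith
  then show ?thesis unfolding q mem_mball_iff[OF R] using * assms by (auto simp: m_def mult_ac)
qed

text \<open>Transfers integrability from balls to cylinders, which suit Fubini's theorem.\<close>

lemma cylinder_subset_mball:
  assumes "x0 \<in> N" "0 < a1"
  obtains R where "0 < R" "N.mball x0 r \<times> {a1..a2} \<subseteq> S.mball (x0, a1) R"
proof -
  \<comment> \<open>This is \<open>cosh (R / c)\<close> for the radius sought. The denominator uses
    the lowest height \<open>a1\<close>; the summand 2 makes the estimate strict and the radius
    positive.\<close>
  define X where "X = (r\<^sup>2 + a1\<^sup>2 + a2\<^sup>2) / (2 * a1\<^sup>2) + 2"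
  have X: "X > 1" unfolding X_def using assms zero_le_divide_iff[of "r\<^sup>2 + a1\<^sup>2 + a2\<^sup>2" "2 * a1\<^sup>2"]
    by (smt (verit) zero_le_power2)
  have "(x, a) \<in> S.mball (x0, a1) (c * arcosh X)" if "x \<in> N.mball x0 r" "a \<in> {a1..a2}" for x a
  proof -
    have "(dN x0 x)\<^sup>2 \<le> r\<^sup>2" using that by (intro power_mono) auto
    moreover have "a\<^sup>2 \<le> a2\<^sup>2" using that assms by (intro power_mono) auto
    ultimately have "(dN x0 x)\<^sup>2 + a1\<^sup>2 + a\<^sup>2 \<le> r\<^sup>2 + a1\<^sup>2 + a2\<^sup>2" by simp
    also have "\<dots> < 2 * a1\<^sup>2 * X" using assms by (simp add: X_def field_simps)
    also have "\<dots> \<le> 2 * a1 * a * X"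
      using that assms X by (intro mult_right_mono) (auto simp: power2_eq_square)
    finally show ?thesis using that assms X c_pos by (subst mem_mball_iff) auto
  qed
  then show ?thesis using X c_pos by (intro that[of "c * arcosh X"]) auto
qed

lemma sets_cylinder [measurable]:
  assumes "0 < a1"
  shows "N.mball x r \<times> {a1..a2} \<in> sets \<rho>"
proof -
  have "{a1..a2} \<in> sets \<nu>" using assms by (simp add: sets_restrict_space_iff subset_iff)
  then show ?thesis unfolding rho_eq by (intro pair_measureI sets_mball)
qed

lemma emeasure_mball_S_finite:
  assumes "0 < R"
  shows "emeasure \<rho> (S.mball (x0, a0) R) < \<infinity>"
proof (cases "0 < a0")
  case True
  define a1 a2 where "a1 = a0 * exp (- (R / c))" and "a2 = a0 * exp (R / c)"
  have a: "0 < a1" "a1 < a2" using True assms c_pos by (auto simp: a1_def a2_def)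
  have sub: "S.mball (x0, a0) R \<subseteq> N.mball x0 (a0 * sinh (R / c)) \<times> {a1..a2}" (is "_ \<subseteq> ?B \<times> _")
  proof safe
    fix x a assume z: "(x, a) \<in> S.mball (x0, a0) R"
    then show "x \<in> ?B" "a \<in> {a1..a2}"
      using mball_subset_cylinder[OF assms z] by (auto simp: a1_def a2_def)
  qed
  have "{a1..a2} \<in> sets \<nu>" using a by (simp add: sets_restrict_space_iff subset_iff)
  then have "emeasure \<rho> (?B \<times> {a1..a2}) = emeasure \<mu> ?B * ennreal (ln (a2 / a1))"
    using emeasure_nu_interval[OF a] unfolding rho_eq
    by (subst P.M2.emeasure_pair_measure_Times) auto
  also have "\<dots> < \<infinity>" using emeasure_mball_finite by (simp add: ennreal_mult_less_top)
  finally show ?thesis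
    using emeasure_mono[OF sub sets_cylinder[OF a(1)]] by (rule order.strict_trans1[rotated])
qed (simp add: S.mball_def)

text \<open>\<open>f\<close> is the pointwise limit of its truncations to balls of growing integer
  radius, on which local integrability provides measurability.\<close>

lemma locally_integrable_measurable:
  assumes "locally_integrable S d \<rho> f"
  shows "f \<in> borel_measurable \<rho>"
proof (cases "S = {}")
  case True
  then show ?thesis by (simp add: measurable_def S.space_mu)
next
  case False
  then obtain q where q: "q \<in> S" by blast
  have "(\<lambda>z. indicator (S.mball q (real (Suc n))) z *\<^sub>R f z) \<in> borel_measurable \<rho>" for n
    using assms q unfolding locally_integrable_def set_integrable_def
    by (intro borel_measurable_integrable) (metis of_nat_0_less_iff zero_less_Suc)
  moreover have "(\<lambda>n. indicator (S.mball q (real (Suc n))) z *\<^sub>R f z) \<longlonglongrightarrow> f z" if "z \<in> space \<rho>" for z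
  proof (rule tendsto_eventually)
    obtain m :: nat where m: "d q z < real m" using reals_Archimedean2 by blast
    have "indicator (S.mball q (real (Suc n))) z *\<^sub>R f z = f z" if "n \<ge> m" for n
      using m q \<open>z \<in> space \<rho>\<close> that by (simp add: S.space_mu)
    then show "\<forall>\<^sub>F n in sequentially. indicator (S.mball q (real (Suc n))) z *\<^sub>R f z = f z"
      by (auto simp: eventually_sequentially)
  qed
  ultimately show ?thesis by (rule borel_measurable_LIMSEQ_metric)
qed

text \<open>Fubini's theorem on the cylinder over \<open>N.mball x0 (real n)\<close> excludes a null
  set of heights for each \<open>n\<close>. Countably many cylinders suffice, because every ball of
  \<open>N\<close> lies in one of these balls.\<close>

lemma AE_locally_integrable_horizontal:
  assumes f: "locally_integrable S d \<rho> f" and a: "0 < a1"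
  shows "AE a in \<nu>. a \<in> {a1..a2} \<longrightarrow> locally_integrable N dN \<mu> (\<lambda>x. f (x, a))"
proof (cases "N = {}")
  case True
  then show ?thesis by (simp add: locally_integrable_def)
next
  case False
  then obtain x0 where x0: "x0 \<in> N" by blast
  have fm[measurable]: "f \<in> borel_measurable \<rho>" using f by (rule locally_integrable_measurable)
  define F where "F n z = ennreal \<bar>f z\<bar> * indicator (N.mball x0 (real n) \<times> {a1..a2}) z" for n z
  have Fm: "F n \<in> borel_measurable \<rho>" for n
    unfolding F_def using sets_cylinder[OF a] by measurable
  have "AE a in \<nu>. (\<integral>\<^sup>+x. F n (x, a) \<partial>\<mu>) \<noteq> \<infinity>" for n
  proof (rule nn_integral_PInf_AE)
    obtain R where R: "0 < R" "N.mball x0 (real n) \<times> {a1..a2} \<subseteq> S.mball (x0, a1) R"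
      using cylinder_subset_mball[OF x0 a] by blast
    have "set_integrable \<rho> (S.mball (x0, a1) R) f"
      using f R x0 a unfolding locally_integrable_def by auto
    then have "(\<integral>\<^sup>+z. ennreal (norm (indicator (S.mball (x0, a1) R) z *\<^sub>R f z)) \<partial>\<rho>) < \<infinity>"
      by (simp add: set_integrable_def integrable_iff_bounded)
    moreover have "(\<integral>\<^sup>+z. F n z \<partial>\<rho>) \<le> (\<integral>\<^sup>+z. ennreal (norm (indicator (S.mball (x0, a1) R) z *\<^sub>R f z)) \<partial>\<rho>)"
      using R by (intro nn_integral_mono) (auto simp: F_def indicator_def)
    moreover have "(\<integral>\<^sup>+z. F n z \<partial>\<rho>) = (\<integral>\<^sup>+a. \<integral>\<^sup>+x. F n (x, a) \<partial>\<mu> \<partial>\<nu>)"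
      using Fm unfolding rho_eq by (rule P.nn_integral_snd[symmetric])
    ultimately show "(\<integral>\<^sup>+a. \<integral>\<^sup>+x. F n (x, a) \<partial>\<mu> \<partial>\<nu>) \<noteq> \<infinity>" by auto
    show "(\<lambda>a. \<integral>\<^sup>+x. F n (x, a) \<partial>\<mu>) \<in> borel_measurable \<nu>"
      using measurable_compose[OF measurable_pair_swap' Fm[unfolded rho_eq]]
      by (intro P.M1.borel_measurable_nn_integral) (simp add: case_prod_unfold)
  qed
  then have "AE a in \<nu>. \<forall>n. (\<integral>\<^sup>+x. F n (x, a) \<partial>\<mu>) \<noteq> \<infinity>" by (simp add: AE_all_countable)
  then show ?thesis
  proof eventually_elim
    case (elim a)
    show ?case unfolding locally_integrable_def set_integrable_def
    proof (intro impI ballI allI integrableI_bounded)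
      fix x r assume a': "a \<in> {a1..a2}" and x: "x \<in> N" and r: "0 < (r::real)"
      have [measurable]: "(\<lambda>x. f (x, a)) \<in> borel_measurable \<mu>"
        using a' a by (intro measurable_horizontal fm) auto
      show "(\<lambda>y. indicator (N.mball x r) y *\<^sub>R f (y, a)) \<in> borel_measurable \<mu>" by measurable
      obtain n :: nat where n: "dN x0 x + r < real n" using reals_Archimedean2 by blast
      have "N.mball x r \<subseteq> N.mball x0 (real n)"
      proof
        fix y assume y: "y \<in> N.mball x r"
        then have "dN x0 y \<le> dN x0 x + dN x y" using x x0 by (intro N.triangle) auto
        then show "y \<in> N.mball x0 (real n)" using y x0 n by auto
      qed
      then have "(\<integral>\<^sup>+y. ennreal (norm (indicator (N.mball x r) y *\<^sub>R f (y, a))) \<partial>\<mu>) \<le> (\<integral>\<^sup>+y. F n (y, a) \<partial>\<mu>)"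
        using a' by (intro nn_integral_mono) (auto simp: F_def indicator_def)
      also have "\<dots> < \<infinity>" using elim by (simp add: less_top)
      finally show "(\<integral>\<^sup>+y. ennreal (norm (indicator (N.mball x r) y *\<^sub>R f (y, a))) \<partial>\<mu>) < \<infinity>" .
    qed
  qed
qed

section \<open>The Poincare inequality\<close>

lemma nn_integral_rho_strip:
  assumes h: "h \<in> borel_measurable \<mu>" and a: "0 < a1" "a1 < a2"
  shows "(\<integral>\<^sup>+z. h (fst z) * indicator {a1..a2} (snd z) \<partial>\<rho>) = ennreal (ln (a2 / a1)) * (\<integral>\<^sup>+x. h x \<partial>\<mu>)"
proof -
  have I: "{a1..a2} \<in> sets \<nu>" using a by (simp add: sets_restrict_space_iff subset_iff)
  then have "(\<lambda>z. h (fst z) * indicator {a1..a2} (snd z)) \<in> borel_measurable (\<mu> \<Otimes>\<^sub>M \<nu>)"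
    using measurable_compose[OF measurable_fst h]
    by (intro borel_measurable_times_ennreal measurable_compose[OF measurable_snd borel_measurable_indicator])
  from P.M2.nn_integral_fst[OF this]
  have "(\<integral>\<^sup>+z. h (fst z) * indicator {a1..a2} (snd z) \<partial>\<rho>) = (\<integral>\<^sup>+x. \<integral>\<^sup>+a. h x * indicator {a1..a2} a \<partial>\<nu> \<partial>\<mu>)"
    by (simp add: rho_eq)
  also have "\<dots> = (\<integral>\<^sup>+x. ennreal (ln (a2 / a1)) * h x \<partial>\<mu>)"
    using I by (simp only: nn_integral_cmult_indicator emeasure_nu_interval[OF a] mult.commute)
  also have "\<dots> = ennreal (ln (a2 / a1)) * (\<integral>\<^sup>+x. h x \<partial>\<mu>)"
    using h by (rule nn_integral_cmult)
  finally show ?thesis .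
qed

text \<open>A Chebyshev argument on a set of slices of positive measure.\<close>

lemma exists_good_height:
  assumes P: "AE a in \<nu>. a \<in> {b1..b2} \<longrightarrow> P a" and b: "0 < b1" "b1 < b2"
    and h[measurable]: "h \<in> borel_measurable \<nu>"
  obtains v where "v \<in> {b1..b2}" "P v" "ennreal (ln (b2 / b1)) * h v \<le> (\<integral>\<^sup>+a. h a \<partial>\<nu>)"
proof -
  let ?J = "{b1..b2}" and ?m = "ennreal (ln (b2 / b1))" and ?G = "\<integral>\<^sup>+a. h a \<partial>\<nu>"
  have J: "?J \<in> sets \<nu>" "emeasure \<nu> ?J = ?m" "?m \<noteq> 0" "?m < \<infinity>"
    using b emeasure_nu_interval[OF b] by (auto simp: sets_restrict_space_iff subset_iff)
  have notnull: "\<not> (AE a in \<nu>. a \<notin> ?J)"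
  proof
    assume "AE a in \<nu>. a \<notin> ?J"
    moreover have eq: "{a \<in> space \<nu>. \<not> a \<notin> ?J} = ?J" using b by auto
    ultimately have "emeasure \<nu> ?J = 0" using AE_iff_measurable[OF J(1) eq] by simp
    then show False using J by simp
  qed
  have "\<exists>v\<in>?J. P v \<and> ?m * h v \<le> ?G"
  proof (rule ccontr)
    assume "\<not> ?thesis"
    then have gt: "?G < ?m * h v" if "v \<in> ?J" "P v" for v using that by (meson not_le)
    \<comment> \<open>With an infinite total integral any height satisfying \<open>P\<close> would
      do. Finiteness is required by the strict comparison of integrals.\<close>
    have fin: "?G < \<infinity>"
    proof (rule ccontr)
      assume "\<not> ?G < \<infinity>"
      then have "?G = \<infinity>" by (simp add: not_less top_unique)
      then have "\<not> P v" if "v \<in> ?J" for v using gt[OF that] by auto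
      then show False using P notnull by auto
    qed
    have [measurable]: "?J \<in> sets \<nu>" by fact
    \<comment> \<open>Integrated over the interval, the strict inequality at all heights satisfying
      \<open>P\<close> would give \<open>?m * ?G < ?m * ?G\<close>.\<close>
    have "(\<integral>\<^sup>+a. ?G * indicator ?J a \<partial>\<nu>) < (\<integral>\<^sup>+a. ?m * (h a * indicator ?J a) \<partial>\<nu>)"
    proof (rule nn_integral_less)
      show "(\<integral>\<^sup>+a. ?G * indicator ?J a \<partial>\<nu>) \<noteq> \<infinity>"
        using fin J(1,4) by (simp add: nn_integral_cmult_indicator J(2) ennreal_mult_eq_top_iff)
      show "AE a in \<nu>. ?G * indicator ?J a \<le> ?m * (h a * indicator ?J a)"
        using P by eventually_elim (use gt in \<open>auto simp: indicator_def intro: less_imp_le\<close>)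
      show "\<not> (AE a in \<nu>. ?m * (h a * indicator ?J a) \<le> ?G * indicator ?J a)"
      proof
        assume "AE a in \<nu>. ?m * (h a * indicator ?J a) \<le> ?G * indicator ?J a"
        with P have "AE a in \<nu>. a \<notin> ?J"
          by eventually_elim (use gt in \<open>force simp: indicator_def not_le\<close>)
        then show False using notnull by simp
      qed
    qed measurable
    also have "\<dots> = ?m * (\<integral>\<^sup>+a. h a * indicator ?J a \<partial>\<nu>)"
      by (rule nn_integral_cmult) measurable
    also have "\<dots> \<le> ?m * ?G"
      by (intro mult_left_mono nn_integral_mono) (auto simp: indicator_def)
    also have "\<dots> = (\<integral>\<^sup>+a. ?G * indicator ?J a \<partial>\<nu>)"
      using nn_integral_cmult_indicator[OF J(1), of ?G] by (simp only: J(2) mult.commute)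
    finally show False by simp
  qed
  then show ?thesis using that by blast
qed

end

section \<open>The estimate through one slice\<close>

locale half_space_poincare = half_space_extension +
  fixes p C \<Lambda> :: real
  assumes p_ge_1: "1 \<le> p" and C_pos: "0 < C" and \<Lambda>_ge_1: "1 \<le> \<Lambda>"
    and poincare: "\<And>x r f g. x \<in> N \<Longrightarrow> 0 < r \<Longrightarrow> locally_integrable N dN \<mu> f \<Longrightarrow> upper_gradient N dN f g \<Longrightarrow>
      (\<integral>\<^sup>+z\<in>N.mball x r. ennreal (\<bar>f z - mean_value \<mu> (N.mball x r) f\<bar> powr p) \<partial>\<mu>)
        \<le> ennreal (C * r powr p) * (\<integral>\<^sup>+z\<in>N.mball x (\<Lambda> * r). ennreal_powr (g z) p \<partial>\<mu>)"
begin

text \<open>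
  The constant is the mean of \<open>f\<close> on a single slice at a height in \<open>[b1, b2]\<close>; every point of \<open>E\<close>
  is joined to that slice by a vertical segment inside the ball.
\<close>

lemma poincare_via_slice:
  assumes f: "locally_integrable S d \<rho> f" and g: "upper_gradient S d f g"
    and x0: "x0 \<in> N" and r: "0 < r" and a: "0 < a1" "a1 \<le> b1" "b1 < b2" "b2 \<le> a2" and R: "0 < R"
    and E: "E \<subseteq> N.mball x0 r \<times> {a1..a2}" "E \<subseteq> S.mball q R"
    and cyl: "N.mball x0 (\<Lambda> * r) \<times> {b1..b2} \<subseteq> S.mball q R"
    and A: "(c * ln (a2 / a1)) powr p + ln (a2 / a1) / ln (b2 / b1) * C * (r * c / b1) powr p \<le> A"
  obtains \<kappa> where "(\<integral>\<^sup>+z\<in>E. ennreal (\<bar>f z - \<kappa>\<bar> powr p) \<partial>\<rho>)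
    \<le> ennreal (2 powr p * A) * (\<integral>\<^sup>+z\<in>S.mball q R. ennreal_powr (g z) p \<partial>\<rho>)"
proof -
  define l m where "l = ln (a2 / a1)" and "m = ln (b2 / b1)"
  have lm: "l > 0" "m > 0" using a by (auto simp: l_def m_def)
  define B where "B = S.mball q R"
  \<comment> \<open>With the cutoff inside \<open>G\<close>, integrals along slices and vertical
    lines can run over the whole slice or line, and Tonelli's theorem compares both with
    \<open>?G\<close>.\<close>
  define G where "G z = ennreal_powr (g z) p * indicator B z" for z
  let ?G = "\<integral>\<^sup>+z. G z \<partial>\<rho>"
  have gm[measurable]: "g \<in> borel_measurable \<rho>" using g by (simp add: upper_gradient_def measurable_borel_alg_S)
  have Bm[measurable]: "B \<in> sets \<rho>" by (simp add: B_def sets_mball)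
  have Gm: "G \<in> borel_measurable \<rho>" unfolding G_def by measurable
  have fm: "f \<in> borel_measurable \<rho>" using f by (rule locally_integrable_measurable)
  define h where "h v = (\<integral>\<^sup>+x. G (x, v) \<partial>\<mu>)" for v
  have hm: "h \<in> borel_measurable \<nu>"
    unfolding h_def using measurable_compose[OF measurable_pair_swap' Gm[unfolded rho_eq]]
    by (intro P.M1.borel_measurable_nn_integral) (simp add: case_prod_unfold)
  have hG: "(\<integral>\<^sup>+v. h v \<partial>\<nu>) = ?G"
    unfolding h_def using Gm unfolding rho_eq by (rule P.nn_integral_snd)
  have b1: "0 < b1" using a by simp
  \<comment> \<open>One height serves two purposes: \<open>f\<close> is locally integrable on its
    slice, so the base inequality applies, and the slice integral \<open>h v\<close> is at most
    \<open>?G / m\<close>.\<close>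
  obtain v where v: "v \<in> {b1..b2}" "locally_integrable N dN \<mu> (\<lambda>x. f (x, v))" "ennreal m * h v \<le> ?G"
    using exists_good_height[OF AE_locally_integrable_horizontal[OF f b1] b1 a(3) hm] unfolding hG m_def by blast
  have v0: "0 < v" using v(1) b1 by simp
  let ?b = "N.mball x0 r"
  define \<kappa> where "\<kappa> = mean_value \<mu> ?b (\<lambda>x. f (x, v))"
  define H where "H x = (\<integral>\<^sup>+w. G (x, w) \<partial>\<nu>)" for x
  have Hm[measurable]: "H \<in> borel_measurable \<mu>"
    unfolding H_def using Gm unfolding rho_eq by (rule P.M2.borel_measurable_nn_integral_fst)
  have HG: "(\<integral>\<^sup>+x. H x \<partial>\<mu>) = ?G"
    unfolding H_def using Gm unfolding rho_eq by (rule P.M2.nn_integral_fst)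
  define k where "k x = ennreal (\<bar>f (x, v) - \<kappa>\<bar> powr p) * indicator ?b x" for x
  have [measurable]: "(\<lambda>x. f (x, v)) \<in> borel_measurable \<mu>" using fm v0 by (rule measurable_horizontal)
  have [measurable]: "(\<lambda>x. g (x, v)) \<in> borel_measurable \<mu>" using gm v0 by (rule measurable_horizontal)
  have km[measurable]: "k \<in> borel_measurable \<mu>" unfolding k_def by measurable
  \<comment> \<open>\<open>c powr p\<close> stems from the vertical upper gradient,
    \<open>l powr (p - 1)\<close> from Hoelder's inequality on an interval of logarithmic length
    \<open>l\<close>.\<close>
  define K where "K = c powr p * l powr (p - 1)"
  have Im: "{a1..a2} \<in> sets \<nu>" using a by (simp add: sets_restrict_space_iff subset_iff)
  have sub: "N.mball x0 r \<subseteq> N.mball x0 (\<Lambda> * r)"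
    using \<Lambda>_ge_1 r by (intro N.mball_subset_concentric) simp
  have vert: "ennreal (\<bar>f (x, u) - f (x, v)\<bar> powr p) \<le> ennreal K * H x" if xu: "(x, u) \<in> E" for x u
  proof -
    have x: "x \<in> N" "x \<in> ?b" and u: "a1 \<le> u" "u \<le> a2" and "(x, u) \<in> B" using xu E unfolding B_def by auto
    moreover have "(x, v) \<in> B" using x(2) sub cyl v unfolding B_def by blast
    ultimately have seg: "(x, w) \<in> B" if "w \<in> {min u v..max u v}" for w
      using mball_vertically_convex[OF R, of x u q v w] mball_vertically_convex[OF R, of x v q u w] that
      unfolding B_def by (cases "u \<le> v") auto
    have [measurable]: "(\<lambda>w. g (x, w)) \<in> borel_measurable \<nu>" "(\<lambda>w. indicator B (x, w) :: ennreal) \<in> borel_measurable \<nu>"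
      using x by (intro measurable_vertical gm borel_measurable_indicator Bm; simp)+
    have "ennreal \<bar>f (x, u) - f (x, v)\<bar> \<le> ennreal c * (\<integral>\<^sup>+w\<in>{min u v..max u v}. g (x, w) \<partial>\<nu>)"
    proof (cases u v rule: linorder_cases)
      case less
      then show ?thesis using upper_gradient_vertical[OF g x(1), of u v] u a by simp
    next
      case greater
      then show ?thesis using upper_gradient_vertical[OF g x(1), of v u] v0
        by (simp add: abs_minus_commute min_def max_def)
    qed simp
    \<comment> \<open>Enlarging the interval makes the bound independent of \<open>u\<close>; the
      indicator may be inserted because the segment lies in \<open>B\<close>.\<close>
    also have "\<dots> \<le> ennreal c * (\<integral>\<^sup>+w\<in>{a1..a2}. g (x, w) * indicator B (x, w) \<partial>\<nu>)"
      using seg u v a by (intro mult_left_mono nn_integral_mono) (auto simp: indicator_def)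
    finally have "ennreal_powr (ennreal \<bar>f (x, u) - f (x, v)\<bar>) p
        \<le> ennreal_powr (ennreal c * (\<integral>\<^sup>+w\<in>{a1..a2}. g (x, w) * indicator B (x, w) \<partial>\<nu>)) p"
      using p_ge_1 by (intro ennreal_powr_mono) auto
    also have "\<dots> = ennreal (c powr p) * ennreal_powr (\<integral>\<^sup>+w\<in>{a1..a2}. g (x, w) * indicator B (x, w) \<partial>\<nu>) p"
      using c_pos by (rule ennreal_powr_mult)
    also have "\<dots> \<le> ennreal (c powr p) * (ennreal (l powr (p - 1)) * (\<integral>\<^sup>+w\<in>{a1..a2}. ennreal_powr (g (x, w) * indicator B (x, w)) p \<partial>\<nu>))"
      using emeasure_nu_interval[of a1 a2] a lm Im p_ge_1
      by (intro mult_left_mono nn_integral_powr_le) (auto simp: l_def)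
    also have "\<dots> \<le> ennreal (c powr p) * (ennreal (l powr (p - 1)) * H x)"
      unfolding H_def G_def
      by (intro mult_left_mono nn_integral_mono) (auto simp: ennreal_powr_indicator indicator_def)
    finally show ?thesis by (simp add: K_def ennreal_mult mult.assoc)
  qed
  have horiz: "(\<integral>\<^sup>+x. k x \<partial>\<mu>) \<le> ennreal (C * (r * c / b1) powr p / m) * ?G"
  proof -
    have "(\<integral>\<^sup>+x. k x \<partial>\<mu>) \<le> ennreal (C * r powr p) * (\<integral>\<^sup>+x\<in>N.mball x0 (\<Lambda> * r). ennreal_powr (ennreal (c / v) * g (x, v)) p \<partial>\<mu>)"
      unfolding k_def \<kappa>_def by (intro poincare x0 r v upper_gradient_horizontal[OF g v0])
    also have "\<dots> \<le> ennreal (C * r powr p) * (\<integral>\<^sup>+x. ennreal ((c / v) powr p) * G (x, v) \<partial>\<mu>)"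
    proof (intro mult_left_mono nn_integral_mono)
      fix x
      have "x \<in> N.mball x0 (\<Lambda> * r) \<Longrightarrow> (x, v) \<in> B" using cyl v(1) unfolding B_def by blast
      then show "ennreal_powr (ennreal (c / v) * g (x, v)) p * indicator (N.mball x0 (\<Lambda> * r)) x
          \<le> ennreal ((c / v) powr p) * G (x, v)"
        using c_pos v0 by (simp add: ennreal_powr_mult G_def indicator_def del: N.in_mball)
    qed simp
    also have "\<dots> = ennreal (C * r powr p) * (ennreal ((c / v) powr p) * h v)"
      unfolding h_def using Gm v0 by (subst nn_integral_cmult) (auto intro: measurable_horizontal)
    also have "\<dots> \<le> ennreal (C * r powr p) * (ennreal ((c / b1) powr p) * (ennreal (1 / m) * ?G))"
    proof (intro mult_left_mono mult_mono)
      show "ennreal ((c / v) powr p) \<le> ennreal ((c / b1) powr p)"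
        using v b1 c_pos p_ge_1 by (intro ennreal_leI powr_mono2 divide_left_mono) auto
      have "h v = ennreal (1 / m) * (ennreal m * h v)"
        using lm by (simp flip: mult.assoc ennreal_mult)
      also have "\<dots> \<le> ennreal (1 / m) * ?G" using v(3) by (intro mult_left_mono) auto
      finally show "h v \<le> ennreal (1 / m) * ?G" .
    qed auto
    also have "\<dots> = ennreal (C * r powr p * (c / b1) powr p * (1 / m)) * ?G"
      using lm C_pos by (simp add: ennreal_mult mult.assoc del: times_divide_eq_right times_divide_eq_left)
    also have "C * r powr p * (c / b1) powr p * (1 / m) = C * (r * c / b1) powr p / m"
      using r c_pos b1 by (simp add: powr_mult powr_divide)
    finally show ?thesis .
  qed
  have "(\<integral>\<^sup>+z\<in>E. ennreal (\<bar>f z - \<kappa>\<bar> powr p) \<partial>\<rho>)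
      \<le> (\<integral>\<^sup>+z. (ennreal (2 powr p) * (ennreal K * H (fst z) + k (fst z))) * indicator {a1..a2} (snd z) \<partial>\<rho>)"
  proof (intro nn_integral_mono)
    fix z :: "'a \<times> real"
    obtain x u where z: "z = (x, u)" by (cases z)
    show "ennreal (\<bar>f z - \<kappa>\<bar> powr p) * indicator E z
      \<le> (ennreal (2 powr p) * (ennreal K * H (fst z) + k (fst z))) * indicator {a1..a2} (snd z)"
    proof (cases "z \<in> E")
      case True
      then have xu: "(x, u) \<in> E" "x \<in> ?b" "u \<in> {a1..a2}" using E z by auto
      have "ennreal (\<bar>f z - \<kappa>\<bar> powr p) = ennreal_powr (ennreal \<bar>f z - \<kappa>\<bar>) p" by simp
      also have "\<dots> \<le> ennreal_powr (ennreal \<bar>f (x, u) - f (x, v)\<bar> + ennreal \<bar>f (x, v) - \<kappa>\<bar>) p"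
        using p_ge_1 by (intro ennreal_powr_mono) (auto simp: z simp flip: ennreal_plus)
      also have "\<dots> \<le> ennreal (2 powr p) * (ennreal (\<bar>f (x, u) - f (x, v)\<bar> powr p) + ennreal (\<bar>f (x, v) - \<kappa>\<bar> powr p))"
        using p_ge_1 ennreal_powr_add_le[of p "ennreal \<bar>f (x, u) - f (x, v)\<bar>" "ennreal \<bar>f (x, v) - \<kappa>\<bar>"] by simp
      also have "\<dots> \<le> ennreal (2 powr p) * (ennreal K * H x + k x)"
        using xu(2) by (intro mult_left_mono add_mono vert[OF xu(1)]) (auto simp: k_def)
      finally show ?thesis using True xu by (simp add: z)
    qed simp
  qed
  \<comment> \<open>The bound depends on the height only through the strip, whence the factor
    \<open>l\<close>. It turns \<open>K\<close> into \<open>(c * l) powr p\<close> and produces the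
    ratio \<open>l / m\<close> in the horizontal term, which are the two summands bounded by
    \<open>A\<close>.\<close>
  also have "\<dots> = ennreal l * (\<integral>\<^sup>+x. ennreal (2 powr p) * (ennreal K * H x + k x) \<partial>\<mu>)"
    unfolding l_def using a by (intro nn_integral_rho_strip) auto
  also have "\<dots> = ennreal l * (ennreal (2 powr p) * (ennreal K * ?G + (\<integral>\<^sup>+x. k x \<partial>\<mu>)))"
    by (simp add: nn_integral_cmult nn_integral_add HG)
  also have "\<dots> \<le> ennreal l * (ennreal (2 powr p) * (ennreal K * ?G + ennreal (C * (r * c / b1) powr p / m) * ?G))"
    by (intro mult_left_mono add_left_mono horiz) auto
  also have "\<dots> = ennreal (2 powr p * (l * K + l / m * C * (r * c / b1) powr p)) * ?G"
  proof -
    have "K \<ge> 0" "C * (r * c / b1) powr p / m \<ge> 0" using lm C_pos by (auto simp: K_def)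
    then have "ennreal K * ?G + ennreal (C * (r * c / b1) powr p / m) * ?G = ennreal (K + C * (r * c / b1) powr p / m) * ?G"
      by (simp only: ennreal_plus distrib_right)
    moreover have "2 powr p * (l * K + l / m * C * (r * c / b1) powr p) = l * (2 powr p * (K + C * (r * c / b1) powr p / m))"
      by (simp add: field_simps)
    ultimately show ?thesis using lm \<open>K \<ge> 0\<close> \<open>C * (r * c / b1) powr p / m \<ge> 0\<close>
      by (simp add: ennreal_mult mult_ac)
  qed
  also have "\<dots> \<le> ennreal (2 powr p * A) * ?G"
  proof -
    have "l * K = (c * l) powr p"
      using lm c_pos powr_mult_base[of l "p - 1"] by (simp add: K_def powr_mult mult_ac)
    then show ?thesis using A unfolding l_def m_def
      by (intro mult_right_mono ennreal_leI mult_left_mono) auto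
  qed
  finally show ?thesis by (intro that) (simp add: G_def B_def)
qed

text \<open>From the outside: \<open>2 * 2 powr p\<close> for passing from \<kappa> to the mean,
  \<open>2 powr p\<close> for splitting \<open>f - \<kappa>\<close> at the slice, then the vertical
  cost \<open>2 powr p\<close>, as the height range has length \<open>2 * R\<close>, and the
  horizontal cost from \<open>bound\<close> below.\<close>

abbreviation (input) "poincare_const \<equiv> 2 * 2 powr p * (2 powr p * (2 powr p + 2 * C * 6 powr p))"

text \<open>Shared by small and large balls, which differ in the lower end \<open>b1\<close> of the
  interval of heights and in the radius \<open>R'\<close>. The left-hand side of
  \<open>bound\<close> is the horizontal cost without \<open>C\<close>: the ratio of logarithmic
  lengths times the power of the base radius measured at height \<open>b1\<close>.\<close>

lemma poincare_ball:
  assumes f: "locally_integrable S d \<rho> f" and g: "upper_gradient S d f g"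
    and x0: "x0 \<in> N" and a0: "0 < a0" and R: "0 < R" "R \<le> R'"
    and b: "a0 * exp (- (R / c)) \<le> b1" "b1 < a0 * exp (R / c)"
    and cyl: "N.mball x0 (\<Lambda> * (a0 * sinh (R / c))) \<times> {b1..a0 * exp (R / c)} \<subseteq> S.mball (x0, a0) R'"
    and bound: "2 * (R / c) / ln (a0 * exp (R / c) / b1) * (a0 * sinh (R / c) * c / b1) powr p \<le> 2 * (6 * R) powr p"
  shows "(\<integral>\<^sup>+z\<in>S.mball (x0, a0) R. ennreal (\<bar>f z - mean_value \<rho> (S.mball (x0, a0) R) f\<bar> powr p) \<partial>\<rho>)
    \<le> ennreal (poincare_const * R powr p) * (\<integral>\<^sup>+z\<in>S.mball (x0, a0) R'. ennreal_powr (g z) p \<partial>\<rho>)"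
proof -
  define k where "k = R / c"
  have k: "k > 0" "R = c * k" using R c_pos by (auto simp: k_def)
  let ?E = "S.mball (x0, a0) R" and ?a1 = "a0 * exp (- k)" and ?a2 = "a0 * exp k"
  have l: "ln (?a2 / ?a1) = 2 * k" using a0 by (simp flip: exp_diff)
  let ?r = "a0 * sinh k" and ?A = "(2 powr p + 2 * C * 6 powr p) * R powr p"
  have pos: "0 < ?r" "0 < ?a1" "?a1 \<le> b1" "b1 < ?a2" "0 < R'"
    using a0 k(1) b R unfolding k_def by auto
  have E: "?E \<subseteq> N.mball x0 ?r \<times> {?a1..?a2}"
  proof safe
    fix x a assume z: "(x, a) \<in> ?E"
    have "x \<in> N" using z by auto
    then show "x \<in> N.mball x0 ?r" "a \<in> {?a1..?a2}"
      using mball_subset_cylinder[OF R(1) z] x0 unfolding k_def by auto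
  qed
  have sub: "?E \<subseteq> S.mball (x0, a0) R'" using R(2) by (rule S.mball_subset_concentric)
  have cyl': "N.mball x0 (\<Lambda> * ?r) \<times> {b1..?a2} \<subseteq> S.mball (x0, a0) R'"
    using cyl unfolding k_def .
  have "(c * (2 * k)) powr p = 2 powr p * R powr p"
    using k c_pos by (simp add: powr_mult mult_ac)
  moreover have "C * (2 * k / ln (?a2 / b1) * (?r * c / b1) powr p) \<le> C * (2 * (6 * R) powr p)"
    using bound C_pos unfolding k_def by (intro mult_left_mono) auto
  moreover have "C * (2 * (6 * R) powr p) = 2 * C * 6 powr p * R powr p"
    using R by (simp add: powr_mult)
  ultimately have A: "(c * ln (?a2 / ?a1)) powr p + ln (?a2 / ?a1) / ln (?a2 / b1) * C * (?r * c / b1) powr p \<le> ?A"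
    unfolding l distrib_right by (simp only: mult_ac)
  obtain \<kappa> where \<kappa>: "(\<integral>\<^sup>+z\<in>?E. ennreal (\<bar>f z - \<kappa>\<bar> powr p) \<partial>\<rho>)
    \<le> ennreal (2 powr p * ?A) * (\<integral>\<^sup>+z\<in>S.mball (x0, a0) R'. ennreal_powr (g z) p \<partial>\<rho>)"
    by (rule poincare_via_slice[OF f g x0 pos(1-4) order_refl pos(5) E sub cyl' A])
  have "set_integrable \<rho> ?E f"
    using f x0 a0 R unfolding locally_integrable_def by auto
  then have "(\<integral>\<^sup>+z\<in>?E. ennreal (\<bar>f z - mean_value \<rho> ?E f\<bar> powr p) \<partial>\<rho>)
      \<le> ennreal (2 * 2 powr p) * (\<integral>\<^sup>+z\<in>?E. ennreal (\<bar>f z - \<kappa>\<bar> powr p) \<partial>\<rho>)"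
    using emeasure_mball_S_finite[OF R(1)] p_ge_1 by (intro nn_integral_mean_value_le sets_mball) auto
  also have "\<dots> \<le> ennreal (2 * 2 powr p) * (ennreal (2 powr p * ((2 powr p + 2 * C * 6 powr p) * R powr p)) * (\<integral>\<^sup>+z\<in>S.mball (x0, a0) R'. ennreal_powr (g z) p \<partial>\<rho>))"
    by (intro mult_left_mono \<kappa>) auto
  also have "\<dots> = ennreal (poincare_const * R powr p) * (\<integral>\<^sup>+z\<in>S.mball (x0, a0) R'. ennreal_powr (g z) p \<partial>\<rho>)"
    unfolding mult.assoc[symmetric] using C_pos by (subst ennreal_mult[symmetric]) (auto simp: mult_ac)
  finally show ?thesis .
qed

section \<open>Small and large balls\<close>

text \<open>For radii up to \<open>c\<close>, heights in the ball differ from \<open>a0\<close> by a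
  factor of at most 3, so the geometry is Euclidean up to constants.\<close>

lemma poincare_small_ball:
  assumes f: "locally_integrable S d \<rho> f" and g: "upper_gradient S d f g"
    and q: "q \<in> S" and R: "0 < R" "R \<le> c"
  shows "(\<integral>\<^sup>+z\<in>S.mball q R. ennreal (\<bar>f z - mean_value \<rho> (S.mball q R) f\<bar> powr p) \<partial>\<rho>)
    \<le> ennreal (poincare_const * R powr p) * (\<integral>\<^sup>+z\<in>S.mball q (7 * \<Lambda> * R). ennreal_powr (g z) p \<partial>\<rho>)"
proof -
  obtain x0 a0 where q_eq: "q = (x0, a0)" by (cases q)
  then have x0: "x0 \<in> N" and a0: "0 < a0" using q by auto
  define k where "k = R / c"
  have k: "0 < k" "k \<le> 1" "R = c * k" using R c_pos by (auto simp: k_def)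
  have "k\<^sup>2 \<le> k" using k by (simp add: power2_eq_square mult_le_cancel_left1)
  then have ek: "exp k \<le> 1 + 2 * k" using exp_bound[of k] k by linarith
  have emk: "1 - k \<le> exp (- k)" using exp_ge_add_one_self[of "- k"] by simp
  have sk: "sinh k \<le> 2 * k" using ek emk k by (simp add: sinh_field_def)
  have "exp k \<le> 3" using ek k by simp
  then have "1 / 3 \<le> 1 / exp k" by (intro divide_left_mono) auto
  then have emk3: "1 / 3 \<le> exp (- k)" by (simp add: exp_minus field_simps)
  show ?thesis unfolding q_eq
  proof (rule poincare_ball[OF f g x0 a0 R(1)])
    have "1 * R \<le> 7 * \<Lambda> * R" using \<Lambda>_ge_1 R by (intro mult_right_mono) auto
    then show R': "R \<le> 7 * \<Lambda> * R" by simp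
    show "a0 * exp (- (R / c)) \<le> a0 * exp (- (R / c))" ..
    show "a0 * exp (- (R / c)) < a0 * exp (R / c)" using a0 k(1) unfolding k_def[symmetric] by simp
    have "a0 * sinh k * c / (a0 * exp (- k)) = c * (sinh k * exp k)"
      using a0 c_pos by (simp add: exp_minus field_simps)
    also have "\<dots> \<le> c * (2 * k * 3)"
      using sk \<open>exp k \<le> 3\<close> k c_pos by (intro mult_left_mono mult_mono) auto
    finally have "(a0 * sinh k * c / (a0 * exp (- k))) powr p \<le> (6 * R) powr p"
      using a0 c_pos k p_ge_1 by (intro powr_mono2) auto
    moreover have "2 * k / ln (a0 * exp k / (a0 * exp (- k))) = 1" using a0 k by (simp flip: exp_diff)
    ultimately have "2 * k / ln (a0 * exp k / (a0 * exp (- k))) * (a0 * sinh k * c / (a0 * exp (- k))) powr p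
        \<le> (6 * R) powr p"
      by (simp only: mult_1_left)
    also have "\<dots> \<le> 2 * (6 * R) powr p" by simp
    finally show "2 * (R / c) / ln (a0 * exp (R / c) / (a0 * exp (- (R / c)))) *
        (a0 * sinh (R / c) * c / (a0 * exp (- (R / c)))) powr p \<le> 2 * (6 * R) powr p"
      unfolding k_def .
    show "N.mball x0 (\<Lambda> * (a0 * sinh (R / c))) \<times> {a0 * exp (- (R / c))..a0 * exp (R / c)}
        \<subseteq> S.mball (x0, a0) (7 * \<Lambda> * R)"
      unfolding k_def[symmetric]
    proof safe
      fix x a assume x: "x \<in> N.mball x0 (\<Lambda> * (a0 * sinh k))" and a: "a \<in> {a0 * exp (- k)..a0 * exp k}"
      define w where "w = a0\<^sup>2 * k\<^sup>2"
      have w: "w > 0" using a0 k by (simp add: w_def)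
      have "\<Lambda> * (a0 * sinh k) \<le> \<Lambda> * (a0 * (2 * k))"
        using sk a0 \<Lambda>_ge_1 by (intro mult_left_mono) auto
      then have "dN x0 x \<le> \<Lambda> * (a0 * (2 * k))" using x by auto
      then have "(dN x0 x)\<^sup>2 \<le> (\<Lambda> * (a0 * (2 * k)))\<^sup>2" by (intro power_mono) auto
      then have D: "(dN x0 x)\<^sup>2 \<le> 4 * \<Lambda>\<^sup>2 * w" by (simp add: w_def power_mult_distrib mult_ac)
      have "a0 * exp k \<le> a0 * (1 + 2 * k)" "a0 * (1 - k) \<le> a0 * exp (- k)"
        using a0 ek emk by (intro mult_left_mono; simp)+
      then have "a \<le> a0 * (1 + 2 * k)" "a0 * (1 - k) \<le> a"
        using a by auto
      then have "\<bar>a - a0\<bar> \<le> a0 * (2 * k)" using a0 k by (auto simp: abs_le_iff algebra_simps)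
      then have "\<bar>a - a0\<bar>\<^sup>2 \<le> (a0 * (2 * k))\<^sup>2" by (intro power_mono) auto
      then have A: "(a - a0)\<^sup>2 \<le> 4 * w" by (simp add: w_def power_mult_distrib mult_ac)
      have \<Lambda>2: "1 * w \<le> \<Lambda>\<^sup>2 * w" using \<Lambda>_ge_1 w by (intro mult_right_mono) auto
      have apos: "a > 0" using a a0 by (auto intro: less_le_trans[of 0 "a0 * exp (- k)"])
      have "a0 * (1 / 3) \<le> a0 * exp (- k)" using a0 emk3 by (intro mult_left_mono) auto
      then have "a0 * (1 / 3) \<le> a" using a by auto
      then have "a0 * (a0 * (1 / 3)) * (49 * \<Lambda>\<^sup>2 * k\<^sup>2) \<le> a0 * a * (49 * \<Lambda>\<^sup>2 * k\<^sup>2)"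
        using a0 by (intro mult_right_mono mult_left_mono) auto
      then have L: "49 / 3 * (\<Lambda>\<^sup>2 * w) \<le> a0 * a * (7 * \<Lambda> * k)\<^sup>2"
        by (simp add: w_def power2_eq_square mult_ac)
      \<comment> \<open>Origin of the 7: the left-hand side is at most
        \<open>8 * \<Lambda>\<^sup>2 * w\<close>, the right-hand side at least
        \<open>49 / 3 * \<Lambda>\<^sup>2 * w\<close>, where the 3 comes from
        \<open>a0 / 3 \<le> a\<close>.\<close>
      have "(dN x0 x)\<^sup>2 + (a - a0)\<^sup>2 < a0 * a * (7 * \<Lambda> * k)\<^sup>2"
        using D A L \<Lambda>2 w by linarith
      also have "a0 * a * (7 * \<Lambda> * k)\<^sup>2 \<le> 2 * a0 * a * (cosh (7 * \<Lambda> * k) - 1)"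
        using cosh_ge_quadratic[of "7 * \<Lambda> * k"] a0 apos
          mult_left_mono[of "(7 * \<Lambda> * k)\<^sup>2" "2 * (cosh (7 * \<Lambda> * k) - 1)" "a0 * a"] by (simp add: mult_ac)
      finally have "(dN x0 x)\<^sup>2 + a0\<^sup>2 + a\<^sup>2 < 2 * a0 * a * cosh (7 * \<Lambda> * k)"
        by (simp add: power2_eq_square algebra_simps)
      then show "(x, a) \<in> S.mball (x0, a0) (7 * \<Lambda> * R)"
        using x x0 a0 apos R R' unfolding k_def
        by (subst mem_mball_iff) (auto simp: less_le_trans)
    qed
  qed
qed

text \<open>The summand 1 compensates for heights one logarithmic unit below the top.
  \<open>\<Lambda>\<^sup>2 + 2\<close> bounds \<open>\<Lambda>\<^sup>2 / 4 + 1 + 1\<close>, the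
  contributions of the base distance, of \<open>a0\<close> and of \<open>a\<close> in units of
  \<open>(a0 * exp k)\<^sup>2\<close>. The factor \<open>c\<close> converts logarithmic height into
  distance.\<close>

definition "gap = c * (1 + ln (\<Lambda>\<^sup>2 + 2))"

lemma gap_pos: "0 < gap"
proof -
  have "1 < \<Lambda>\<^sup>2 + 2" using zero_le_power2[of \<Lambda>] by linarith
  then have "0 < ln (\<Lambda>\<^sup>2 + 2)" by (rule ln_gt_zero)
  then show ?thesis using c_pos by (simp add: gap_def)
qed

text \<open>
  The slices of the ball of radius \<open>R + gap\<close> are larger than those of the ball of radius \<open>R\<close> by a
  factor at least \<open>\<Lambda>\<close>, which absorbs the dilation in the Poincare inequality of the base.
\<close>

lemma poincare_large_ball:
  assumes f: "locally_integrable S d \<rho> f" and g: "upper_gradient S d f g"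
    and q: "q \<in> S" and R: "c \<le> R"
  shows "(\<integral>\<^sup>+z\<in>S.mball q R. ennreal (\<bar>f z - mean_value \<rho> (S.mball q R) f\<bar> powr p) \<partial>\<rho>)
    \<le> ennreal (poincare_const * R powr p) * (\<integral>\<^sup>+z\<in>S.mball q (R + gap). ennreal_powr (g z) p \<partial>\<rho>)"
proof -
  obtain x0 a0 where q_eq: "q = (x0, a0)" by (cases q)
  then have x0: "x0 \<in> N" and a0: "0 < a0" using q by auto
  define k where "k = R / c"
  have k: "1 \<le> k" "R = c * k" using R c_pos by (auto simp: k_def)
  have R0: "0 < R" using R c_pos by simp
  have sk: "sinh k \<le> exp k / 2" by (simp add: sinh_field_def)
  have b1: "a0 * exp (k - 1) > 0" using a0 by simp
  show ?thesis unfolding q_eq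
  proof (rule poincare_ball[OF f g x0 a0 R0])
    show "R \<le> R + gap" using gap_pos by simp
    show "a0 * exp (- (R / c)) \<le> a0 * exp (k - 1)" "a0 * exp (k - 1) < a0 * exp (R / c)"
      using a0 k(1) unfolding k_def[symmetric] by simp_all
    \<comment> \<open>At heights from \<open>a0 * exp (k - 1)\<close> upwards the base radius
      measures at most \<open>3 / 2 * c\<close>, whatever \<open>R\<close> is.\<close>
    have "a0 * sinh k * c / (a0 * exp (k - 1)) = c * (sinh k / exp k * exp 1)"
      using a0 c_pos by (simp add: exp_diff field_simps)
    also have "\<dots> \<le> c * (1 / 2 * 3)"
      using sk exp_le c_pos k by (intro mult_left_mono mult_mono) (auto simp: field_simps)
    also have "\<dots> \<le> 6 * c" using c_pos by simp
    finally have "(a0 * sinh k * c / (a0 * exp (k - 1))) powr p \<le> (6 * c) powr p"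
      using a0 c_pos k(1) p_ge_1 by (intro powr_mono2) auto
    \<comment> \<open>This absorbs the ratio \<open>2 * k\<close> of logarithmic lengths and rests
      on \<open>1 \<le> k\<close>, that is, on \<open>c \<le> R\<close>.\<close>
    moreover have "k \<le> k powr p" using powr_mono[of 1 p k] p_ge_1 k by simp
    ultimately have "2 * k * (a0 * sinh k * c / (a0 * exp (k - 1))) powr p \<le> 2 * k powr p * (6 * c) powr p"
      using k by (intro mult_mono) auto
    also have "\<dots> = 2 * (6 * R) powr p" using k c_pos by (simp add: powr_mult mult_ac)
    moreover have "ln (a0 * exp k / (a0 * exp (k - 1))) = 1" using a0 by (simp flip: exp_diff)
    ultimately show "2 * (R / c) / ln (a0 * exp (R / c) / (a0 * exp (k - 1))) *
        (a0 * sinh (R / c) * c / (a0 * exp (k - 1))) powr p \<le> 2 * (6 * R) powr p"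
      unfolding k_def[symmetric] by simp
    show "N.mball x0 (\<Lambda> * (a0 * sinh (R / c))) \<times> {a0 * exp (k - 1)..a0 * exp (R / c)} \<subseteq> S.mball (x0, a0) (R + gap)"
      unfolding k_def[symmetric]
    proof safe
      fix x a assume x: "x \<in> N.mball x0 (\<Lambda> * (a0 * sinh k))" and a: "a \<in> {a0 * exp (k - 1)..a0 * exp k}"
      define e where "e = a0\<^sup>2 * (exp k)\<^sup>2"
      have e: "e > 0" using a0 by (simp add: e_def)
      have apos: "a > 0" using a b1 by auto
      have "\<Lambda> * (a0 * sinh k) \<le> \<Lambda> * (a0 * (exp k / 2))"
        using sk a0 \<Lambda>_ge_1 by (intro mult_left_mono) auto
      then have "dN x0 x \<le> \<Lambda> * (a0 * (exp k / 2))" using x by auto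
      then have "(dN x0 x)\<^sup>2 \<le> (\<Lambda> * (a0 * (exp k / 2)))\<^sup>2" by (intro power_mono) auto
      then have D: "(dN x0 x)\<^sup>2 \<le> \<Lambda>\<^sup>2 * e / 4" by (simp add: e_def power_mult_distrib power_divide mult_ac)
      have "a\<^sup>2 \<le> (a0 * exp k)\<^sup>2" using a apos by (intro power_mono) auto
      then have A: "a\<^sup>2 \<le> e" by (simp add: e_def power_mult_distrib)
      have "1\<^sup>2 \<le> (exp k)\<^sup>2" using k by (intro power_mono) auto
      then have A0: "a0\<^sup>2 \<le> e" using mult_left_mono[of 1 "(exp k)\<^sup>2" "a0\<^sup>2"] by (simp add: e_def)
      have R': "(R + gap) / c = k + (1 + ln (\<Lambda>\<^sup>2 + 2))" using k c_pos by (simp add: gap_def add_divide_distrib)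
      have \<Lambda>2: "\<Lambda>\<^sup>2 + 2 > 0" by (simp add: add_nonneg_pos)
      have "0 < \<Lambda>\<^sup>2 * e" using \<Lambda>_ge_1 e by simp
      then have "(dN x0 x)\<^sup>2 + a0\<^sup>2 + a\<^sup>2 < (\<Lambda>\<^sup>2 + 2) * e"
        using D A A0 unfolding distrib_right by linarith
      \<comment> \<open>\<open>a0 * exp (k - 1)\<close> is the lowest height in the cylinder, and
        \<open>2 * cosh t\<close> exceeds \<open>exp t\<close>.\<close>
      also have "\<dots> = a0 * (a0 * exp (k - 1)) * exp (k + (1 + ln (\<Lambda>\<^sup>2 + 2)))"
        using \<Lambda>2 by (simp add: e_def exp_add exp_diff power2_eq_square mult_ac)
      also have "\<dots> \<le> a0 * a * (2 * cosh (k + (1 + ln (\<Lambda>\<^sup>2 + 2))))"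
        using a a0 apos by (intro mult_mono) (auto simp: cosh_field_def)
      finally have "(dN x0 x)\<^sup>2 + a0\<^sup>2 + a\<^sup>2 < 2 * a0 * a * cosh ((R + gap) / c)"
        unfolding R' by (simp add: mult_ac)
      then show "(x, a) \<in> S.mball (x0, a0) (R + gap)"
        using x x0 a0 apos R0 gap_pos by (subst mem_mball_iff) auto
    qed
  qed
qed

lemma supports_global_poincare_half_space: "supports_global_poincare S d \<rho> p"
  unfolding supports_global_poincare_def Let_def
proof (intro exI conjI ballI allI impI)
  \<comment> \<open>\<open>7 * \<Lambda>\<close> serves radii up to \<open>c\<close>; beyond,
    \<open>R + gap \<le> (1 + gap / c) * R\<close> turns the additive enlargement into a
    dilation.\<close>
  let ?\<Lambda> = "max (7 * \<Lambda>) (1 + gap / c)"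
  show "0 < poincare_const" using C_pos by (simp add: add_pos_pos)
  show "1 \<le> ?\<Lambda>" using \<Lambda>_ge_1 by simp
  fix q :: "'a \<times> real" and R :: real and f g
  assume q: "q \<in> S" and R: "0 < R" and f: "locally_integrable S d \<rho> f" and g: "upper_gradient S d f g"
  obtain R' where R': "R' \<le> ?\<Lambda> * R"
    "(\<integral>\<^sup>+z\<in>S.mball q R. ennreal (\<bar>f z - mean_value \<rho> (S.mball q R) f\<bar> powr p) \<partial>\<rho>)
      \<le> ennreal (poincare_const * R powr p) * (\<integral>\<^sup>+z\<in>S.mball q R'. ennreal_powr (g z) p \<partial>\<rho>)"
  proof (cases "R \<le> c")
    case True
    have "7 * \<Lambda> * R \<le> ?\<Lambda> * R" using R by (intro mult_right_mono) auto
    then show ?thesis using poincare_small_ball[OF f g q R True] that by blast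
  next
    case False
    then have "gap * c \<le> gap * R" using gap_pos by (intro mult_left_mono) auto
    then have "R + gap \<le> (1 + gap / c) * R" using c_pos by (simp add: field_simps)
    also have "\<dots> \<le> ?\<Lambda> * R" using R by (intro mult_right_mono) auto
    finally show ?thesis using poincare_large_ball[OF f g q, of R] False that by auto
  qed
  have "S.mball q R' \<subseteq> S.mball q (?\<Lambda> * R)" using R'(1) by (rule S.mball_subset_concentric)
  then have "(\<integral>\<^sup>+z\<in>S.mball q R'. ennreal_powr (g z) p \<partial>\<rho>) \<le> (\<integral>\<^sup>+z\<in>S.mball q (?\<Lambda> * R). ennreal_powr (g z) p \<partial>\<rho>)"
    by (intro nn_integral_mono mult_left_mono) (auto simp: indicator_def simp del: S.in_mball)
  with R'(2) show "(\<integral>\<^sup>+z\<in>S.mball q R. ennreal (\<bar>f z - mean_value \<rho> (S.mball q R) f\<bar> powr p) \<partial>\<rho>)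
      \<le> ennreal (poincare_const * R powr p) * (\<integral>\<^sup>+z\<in>S.mball q (?\<Lambda> * R). ennreal_powr (g z) p \<partial>\<rho>)"
    by (blast intro: order_trans mult_left_mono zero_le)
qed

end

theorem theorem1p1:
  fixes N :: "'a set" and dN :: "'a \<Rightarrow> 'a \<Rightarrow> real" and \<mu>N :: "'a measure"
    and C\<^sub>N p :: real
  defines "S \<equiv> half_space N"
    and "dS \<equiv> half_space_dist C\<^sub>N dN"
    and "\<rho> \<equiv> half_space_measure \<mu>N"
  assumes "metric_measure_space N dN \<mu>N"
    and "geodesic_space N dN"
    and "doubling N dN \<mu>N"
    and "0 < C\<^sub>N"
    and "1 \<le> p"
    and "supports_global_poincare N dN \<mu>N p"
  shows "supports_global_poincare S dS \<rho> p \<and>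
    (\<exists>C\<^sub>p>0. \<exists>\<C>>0. \<exists>R\<^sub>0>0. \<forall>x\<^sub>0\<in>S. \<forall>R\<ge>R\<^sub>0. \<forall>f g.
       locally_integrable S dS \<rho> f \<longrightarrow> upper_gradient S dS f g \<longrightarrow>
       (\<integral>\<^sup>+z\<in>Metric_space.mball S dS x\<^sub>0 R.
           ennreal (\<bar>f z - mean_value \<rho> (Metric_space.mball S dS x\<^sub>0 R) f\<bar> powr p) \<partial>\<rho>)
         \<le> ennreal (C\<^sub>p * R powr p) *
           (\<integral>\<^sup>+z\<in>Metric_space.mball S dS x\<^sub>0 (R + \<C>). ennreal_powr (g z) p \<partial>\<rho>))"
proof -
  obtain C \<Lambda> where "C > 0" "\<Lambda> \<ge> 1"
    and "\<And>x r f g. x \<in> N \<Longrightarrow> 0 < r \<Longrightarrow> locally_integrable N dN \<mu>N f \<Longrightarrow> upper_gradient N dN f g \<Longrightarrow>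
      (\<integral>\<^sup>+z\<in>Metric_space.mball N dN x r. ennreal (\<bar>f z - mean_value \<mu>N (Metric_space.mball N dN x r) f\<bar> powr p) \<partial>\<mu>N)
        \<le> ennreal (C * r powr p) * (\<integral>\<^sup>+z\<in>Metric_space.mball N dN x (\<Lambda> * r). ennreal_powr (g z) p \<partial>\<mu>N)"
    using \<open>supports_global_poincare N dN \<mu>N p\<close> unfolding supports_global_poincare_def Let_def by blast
  then interpret H: half_space_poincare N dN \<mu>N C\<^sub>N p C \<Lambda>
    using assms by unfold_locales (auto simp: metric_measure_space_def metric_measure_space_axioms_def Metric_space_def)
  \<comment> \<open>This number is the witness for \<open>C\<^sub>p\<close>; those for \<C> and
    \<open>R\<^sub>0\<close> are \<open>H.gap\<close> and \<open>C\<^sub>N\<close>, the least radius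
    covered by \<open>poincare_large_ball\<close>.\<close>
  have "0 < 2 * 2 powr p * (2 powr p * (2 powr p + 2 * C * 6 powr p))"
    using \<open>C > 0\<close> by (simp add: add_pos_pos)
  then show ?thesis
    unfolding S_def dS_def \<rho>_def
    using H.supports_global_poincare_half_space H.gap_pos H.poincare_large_ball \<open>0 < C\<^sub>N\<close> by blast
qed

end
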